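(* Let $(G_n,R^m_n)$ be a sequence in $\mathbf{B}$ such that every $G_n$ is a tree, and let $\mathbb{P}$ be the induced poset. The following are equivalent: (1) $\mathsf{S}\mathbb{P}$ is connected and Hausdorff; (2) $(G_n,R^m_n)$ has an edge-witnessing subsequence and a star-refining subsequence. If these conditions hold, then $(G_n,R^m_n)$ is edge-faithful and $\mathsf{S}\mathbb{P}$ is a tree-like continuum. If moreover $(G_n,R^m_n)$ is monotone, then $\mathsf{S}\mathbb{P}$ is a dendrite.
   Context: Graphs and relations. A graph is a finite non-empty set $G$ with a reflexive symmetric relation $\sqcap$ (the edge relation); a tree is a connected acyclic graph (loops disregarded; a single vertex is allowed). A subset of a graph is connected if it cannot be split into two non-empty parts with no edge between them (the empty set is connected). A relation $R\subseteq H\times G$ between graphs is viewed as a relation from $G$ to $H$; write $R(g)=\{h:(h,g)\in R\}$ and $R^{-1}(h)=\{g:(h,g)\in R\}$; $(c,a)\in Q\circ R$ iff $(c,b)\in Q$ and $(b,a)\in R$ for some $b$. $R$ is: edge-preserving if $(h,g),(h',g')\in R$ and $g\sqcap g'$ imply $h\sqcap h'$; co-bijective if $R(g)\ne\emptyset$ for all $g$ and for all $h\in H$ there is $g$ with $R(g)=\{h\}$; edge-witnessing if $h\sqcap h'$ implies there is $g$ with $(h,g),(h',g)\in R$; star-refining if for all $g\in G$ there is $h\in H$ with $\{g':g'\sqcap g\}\subseteq R^{-1}(h)$; monotone if $\bigcup_{h\in C}R^{-1}(h)$ is connected for every connected $C\subseteq H$. $\mathbf{B}$ is the category of graphs with co-bijective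 edge-preserving relations as morphisms. Sequences. A sequence in $\mathbf{B}$ is a family $(G_n,R^m_n)_{m\le n\in\omega}$ with $R^m_n$ a morphism of $\mathbf{B}$ from $G_n$ to $G_m$, $R^n_n$ the identity and $R^l_m\circ R^m_n=R^l_n$ for $l\le m\le n$. It has a property of morphisms if $R^m_n$ has it for all $m<n$. A subsequence is $(G_{\phi(n)},R^{\phi(m)}_{\phi(n)})$ for a strictly increasing $\phi:\omega\to\omega$. The induced poset is the disjoint union $\mathbb{P}=\bigsqcup_nG_n$, where for $p\in G_n$, $q\in G_m$, $p\le q$ iff $m\le n$ and $(q,p)\in R^m_n$. The sequence is edge-faithful if for all $n$ and $g,h\in G_n$: $g\sqcap h$ iff $g,h$ have a common lower bound in $\mathbb{P}$. Spectrum. In a poset $\mathbb{P}$, a band is a finite $B\subseteq\mathbb{P}$ such that every element of $\mathbb{P}$ is comparable to an element of $B$; a cap is a set $C\subseteq\mathbb P$ for which there is a band $B$ such that each $b\in B$ is $\le$ some $c\in C$; a selector is a subset of $\mathbb{P}$ meeting every cap. The spectrum $\mathsf{S}\mathbb{P}$ is the set of minimal selectors (with respect to inclusion) with the topology generated by the sets $p^\in=\{S\in\mathsf{S}\mathbb{P}:p\in S\}$, $p\in\mathbb{P}$. Continua. A continuum is a non-empty compact connected metrizable space (one-point spaces allowed). It is tree-like if every open cover is refined by a finite open cover whose overlap graph (vertices: members of the cover; edges: pairs with non-empty intersection) is a tree. A dendrite is a locally connected continuum that is tree-like (equivalently, hereditarily unicoherent: the intersection of any two subcontinua is connected; equivalently,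 containing no circle). *)

theory Defs
  imports "HOL-Analysis.Analysis"
begin

record 'a rgraph =
  verts :: "'a set"
  adj :: "('a \<times> 'a) set"

definition graph :: "'a rgraph \<Rightarrow> bool" where
  "graph G \<longleftrightarrow> finite (verts G) \<and> verts G \<noteq> {} \<and> adj G \<subseteq> verts G \<times> verts G \<and>
     refl_on (verts G) (adj G) \<and> sym (adj G)"

definition gconnected :: "'a rgraph \<Rightarrow> 'a set \<Rightarrow> bool" where
  "gconnected G C \<longleftrightarrow> C \<subseteq> verts G \<and>
     \<not> (\<exists>A B. A \<noteq> {} \<and> B \<noteq> {} \<and> A \<union> B = C \<and> A \<inter> B = {} \<and> (\<forall>a\<in>A. \<forall>b\<in>B. (a, b) \<notin> adj G))"

text \<open>Cycles have at least three distinct vertices, so loops do not count.\<close>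

definition gcycle :: "'a rgraph \<Rightarrow> 'a list \<Rightarrow> bool" where
  "gcycle G xs \<longleftrightarrow> length xs \<ge> 3 \<and> distinct xs \<and> set xs \<subseteq> verts G \<and>
     successively (\<lambda>x y. (x, y) \<in> adj G) xs \<and> (last xs, hd xs) \<in> adj G"

definition tree :: "'a rgraph \<Rightarrow> bool" where
  "tree G \<longleftrightarrow> graph G \<and> gconnected G (verts G) \<and> (\<nexists>xs. gcycle G xs)"

text \<open>A relation \<open>R\<close> from \<open>G\<close> to \<open>H\<close> is a subset of \<open>verts H \<times> verts G\<close>: targets come first.
  Hence \<open>R(g)\<close> is \<open>R\<inverse> `` {g}\<close>, the preimage of \<open>C \<subseteq> verts H\<close> is \<open>R `` C\<close>,
  and \<open>Q \<circ> R\<close> is \<open>Q O R\<close>. In all predicates below the source \<open>G\<close> precedes the target \<open>H\<close>.\<close>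

definition edge_preserving :: "'a rgraph \<Rightarrow> 'b rgraph \<Rightarrow> ('b \<times> 'a) set \<Rightarrow> bool" where
  "edge_preserving G H R \<longleftrightarrow>
     (\<forall>h g h' g'. (h, g) \<in> R \<and> (h', g') \<in> R \<and> (g, g') \<in> adj G \<longrightarrow> (h, h') \<in> adj H)"

definition co_bijective :: "'a rgraph \<Rightarrow> 'b rgraph \<Rightarrow> ('b \<times> 'a) set \<Rightarrow> bool" where
  "co_bijective G H R \<longleftrightarrow>
     (\<forall>g\<in>verts G. R\<inverse> `` {g} \<noteq> {}) \<and> (\<forall>h\<in>verts H. \<exists>g\<in>verts G. R\<inverse> `` {g} = {h})"

definition edge_witnessing :: "'a rgraph \<Rightarrow> 'b rgraph \<Rightarrow> ('b \<times> 'a) set \<Rightarrow> bool" where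
  "edge_witnessing G H R \<longleftrightarrow>
     (\<forall>h h'. (h, h') \<in> adj H \<longrightarrow> (\<exists>g\<in>verts G. (h, g) \<in> R \<and> (h', g) \<in> R))"

definition star_refining :: "'a rgraph \<Rightarrow> 'b rgraph \<Rightarrow> ('b \<times> 'a) set \<Rightarrow> bool" where
  "star_refining G H R \<longleftrightarrow>
     (\<forall>g\<in>verts G. \<exists>h\<in>verts H. {g' \<in> verts G. (g', g) \<in> adj G} \<subseteq> R `` {h})"

definition monotone_rel :: "'a rgraph \<Rightarrow> 'b rgraph \<Rightarrow> ('b \<times> 'a) set \<Rightarrow> bool" where
  "monotone_rel G H R \<longleftrightarrow> (\<forall>C. gconnected H C \<longrightarrow> gconnected G (R `` C))"

definition B_morphism :: "'a rgraph \<Rightarrow> 'b rgraph \<Rightarrow> ('b \<times> 'a) set \<Rightarrow> bool" where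
  "B_morphism G H R \<longleftrightarrow> graph G \<and> graph H \<and> R \<subseteq> verts H \<times> verts G \<and>
     co_bijective G H R \<and> edge_preserving G H R"

text \<open>\<open>R m n\<close> is the relation \<open>R\<^sup>m\<^sub>n\<close> from \<open>G n\<close> to \<open>G m\<close>; only its values for \<open>m \<le> n\<close> matter.
  The vertices of all graphs are taken from one type. The graphs need not be disjoint, as the
  induced poset tags each vertex with its index.\<close>

definition B_sequence :: "(nat \<Rightarrow> 'a rgraph) \<Rightarrow> (nat \<Rightarrow> nat \<Rightarrow> ('a \<times> 'a) set) \<Rightarrow> bool" where
  "B_sequence G R \<longleftrightarrow>
     (\<forall>m n. m \<le> n \<longrightarrow> B_morphism (G n) (G m) (R m n)) \<and>
     (\<forall>n. R n n = Id_on (verts (G n))) \<and>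
     (\<forall>l m n. l \<le> m \<and> m \<le> n \<longrightarrow> R l m O R m n = R l n)"

definition seq_has ::
  "('a rgraph \<Rightarrow> 'a rgraph \<Rightarrow> ('a \<times> 'a) set \<Rightarrow> bool) \<Rightarrow>
   (nat \<Rightarrow> 'a rgraph) \<Rightarrow> (nat \<Rightarrow> nat \<Rightarrow> ('a \<times> 'a) set) \<Rightarrow> bool" where
  "seq_has P G R \<longleftrightarrow> (\<forall>m n. m < n \<longrightarrow> P (G n) (G m) (R m n))"

definition has_subseq_with ::
  "('a rgraph \<Rightarrow> 'a rgraph \<Rightarrow> ('a \<times> 'a) set \<Rightarrow> bool) \<Rightarrow>
   (nat \<Rightarrow> 'a rgraph) \<Rightarrow> (nat \<Rightarrow> nat \<Rightarrow> ('a \<times> 'a) set) \<Rightarrow> bool" where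
  "has_subseq_with P G R \<longleftrightarrow>
     (\<exists>\<phi>::nat \<Rightarrow> nat. strict_mono \<phi> \<and>
        seq_has P (\<lambda>n. G (\<phi> n)) (\<lambda>m n. R (\<phi> m) (\<phi> n)))"

definition induced_carrier :: "(nat \<Rightarrow> 'a rgraph) \<Rightarrow> (nat \<times> 'a) set" where
  "induced_carrier G = (SIGMA n:UNIV. verts (G n))"

text \<open>A pair \<open>(p, q)\<close> in an order relation means \<open>p \<le> q\<close>.\<close>

definition induced_order ::
  "(nat \<Rightarrow> 'a rgraph) \<Rightarrow> (nat \<Rightarrow> nat \<Rightarrow> ('a \<times> 'a) set) \<Rightarrow> ((nat \<times> 'a) \<times> (nat \<times> 'a)) set" where
  "induced_order G R =
     {((n, p), (m, q)) | n p m q. p \<in> verts (G n) \<and> q \<in> verts (G m) \<and> m \<le> n \<and> (q, p) \<in> R m n}"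

definition edge_faithful ::
  "(nat \<Rightarrow> 'a rgraph) \<Rightarrow> (nat \<Rightarrow> nat \<Rightarrow> ('a \<times> 'a) set) \<Rightarrow> bool" where
  "edge_faithful G R \<longleftrightarrow>
     (\<forall>n. \<forall>g\<in>verts (G n). \<forall>h\<in>verts (G n).
        (g, h) \<in> adj (G n) \<longleftrightarrow>
        (\<exists>p\<in>induced_carrier G.
           (p, (n, g)) \<in> induced_order G R \<and> (p, (n, h)) \<in> induced_order G R))"

text \<open>A poset is given by its carrier \<open>P\<close> and its order relation \<open>r\<close>.\<close>

definition band :: "'p set \<Rightarrow> ('p \<times> 'p) set \<Rightarrow> 'p set \<Rightarrow> bool" where
  "band P r B \<longleftrightarrow> finite B \<and> B \<subseteq> P \<and> (\<forall>p\<in>P. \<exists>b\<in>B. (p, b) \<in> r \<or> (b, p) \<in> r)"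

definition cap :: "'p set \<Rightarrow> ('p \<times> 'p) set \<Rightarrow> 'p set \<Rightarrow> bool" where
  "cap P r C \<longleftrightarrow> C \<subseteq> P \<and> (\<exists>B. band P r B \<and> (\<forall>b\<in>B. \<exists>c\<in>C. (b, c) \<in> r))"

definition selector :: "'p set \<Rightarrow> ('p \<times> 'p) set \<Rightarrow> 'p set \<Rightarrow> bool" where
  "selector P r S \<longleftrightarrow> S \<subseteq> P \<and> (\<forall>C. cap P r C \<longrightarrow> S \<inter> C \<noteq> {})"

definition spectrum_points :: "'p set \<Rightarrow> ('p \<times> 'p) set \<Rightarrow> 'p set set" where
  "spectrum_points P r = {S. selector P r S \<and> (\<forall>T. selector P r T \<and> T \<subseteq> S \<longrightarrow> T = S)}"

text \<open>The whole space is added to the subbase because \<open>topology_generated_by\<close> takes the union of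
  the generating family as underlying set.\<close>

definition spectrum :: "'p set \<Rightarrow> ('p \<times> 'p) set \<Rightarrow> 'p set topology" where
  "spectrum P r = topology_generated_by
     (insert (spectrum_points P r) ((\<lambda>p. {S \<in> spectrum_points P r. p \<in> S}) ` P))"

definition continuum :: "'x topology \<Rightarrow> bool" where
  "continuum X \<longleftrightarrow> topspace X \<noteq> {} \<and> compact_space X \<and> connected_space X \<and> metrizable_space X"

definition open_cover :: "'x topology \<Rightarrow> 'x set set \<Rightarrow> bool" where
  "open_cover X \<U> \<longleftrightarrow> (\<forall>U\<in>\<U>. openin X U) \<and> \<Union>\<U> = topspace X"

definition overlap_graph :: "'x set set \<Rightarrow> 'x set rgraph" where
  "overlap_graph \<U> =
     \<lparr>verts = \<U>, adj = {(U, V). U \<in> \<U> \<and> V \<in> \<U> \<and> U \<inter> V \<noteq> {}}\<rparr>"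

definition tree_like :: "'x topology \<Rightarrow> bool" where
  "tree_like X \<longleftrightarrow>
     (\<forall>\<U>. open_cover X \<U> \<longrightarrow>
        (\<exists>\<V>. finite \<V> \<and> open_cover X \<V> \<and> (\<forall>V\<in>\<V>. \<exists>U\<in>\<U>. V \<subseteq> U) \<and> tree (overlap_graph \<V>)))"

definition dendrite :: "'x topology \<Rightarrow> bool" where
  "dendrite X \<longleftrightarrow> continuum X \<and> locally_connected_space X \<and> tree_like X"

end

theory Submission
  imports Defs
begin

text \<open>
  Caps are exactly the sets refined by some level \<open>G n\<close>. Hence a selector is a set whose complement is
  not a cap, a minimal selector is an up-closed filter meeting every level in a clique, and every
  open cover of the spectrum is refined by the basic open sets of all deep enough levels.

  Removing an edge of a tree leaves two parts joined by that edge only. So if the spectrum is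
  connected, the open sets belonging to the two parts overlap, which yields a common lower bound of
  the ends of the edge: the sequence is edge-faithful. The same splitting lifts every edge to all
  deeper levels, so an edge-witnessing subsequence also makes the sequence edge-faithful, and then
  a clopen partition of the spectrum would disconnect some \<open>G n\<close>. Given edge-faithfulness, the basic
  open sets of \<open>G n\<close> form a cover whose overlap graph is isomorphic to \<open>G n\<close>, and under monotonicity
  the closures of basic open sets are connected.
\<close>

subsection \<open>Metrizability and trees\<close>

text \<open>Urysohn's argument: the space is embedded in a product of real lines, with one
  coordinate for each pair of basic open sets that some continuous function separates at
  \<open>1/2\<close>. Countability of the base makes the product metrizable, and compactness turns
  the continuous injection into a closed map.\<close>

lemma compact_Hausdorff_second_countable_imp_metrizable_space:
  assumes "compact_space X" "Hausdorff_space X" "second_countable X"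
  shows "metrizable_space X"
proof -
  obtain \<B> where \<B>: "countable \<B>" "\<And>V. V \<in> \<B> \<Longrightarrow> openin X V"
    "\<And>U x. openin X U \<Longrightarrow> x \<in> U \<Longrightarrow> \<exists>V\<in>\<B>. x \<in> V \<and> V \<subseteq> U"
    using assms(3) unfolding second_countable_def by metis
  define sep where "sep = (\<lambda>(V, W) f. continuous_map X euclideanreal f \<and>
    f ` V \<subseteq> {..<1/2} \<and> f ` W \<subseteq> {1/2<..})"
  define I where "I = {i \<in> \<B> \<times> \<B>. \<exists>f. sep i f}"
  define f where "f = (\<lambda>i. SOME f. sep i f)"
  have f: "sep i (f i)" if "i \<in> I" for i
    using that someI_ex[of "sep i"] by (auto simp: I_def f_def)
  define F where "F = (\<lambda>x. \<lambda>i\<in>I. f i x)"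
  let ?Y = "product_topology (\<lambda>i. euclideanreal) I"
  have cont: "continuous_map X ?Y F"
    unfolding continuous_map_componentwise F_def using f by (auto simp: sep_def)
  have inj: "inj_on F (topspace X)"
  proof (rule inj_onI, rule ccontr)
    fix x y assume xy: "x \<in> topspace X" "y \<in> topspace X" "F x = F y" "x \<noteq> y"
    have "normal_space X"
      using assms by (simp add: compact_Hausdorff_or_regular_imp_normal_space)
    then obtain g where g: "continuous_map X euclideanreal g" "g ` {x} \<subseteq> {0}" "g ` {y} \<subseteq> {1}"
      using Urysohn_lemma_alt[of X "{x}" "{y}"] xy assms
      by (metis closedin_Hausdorff_singleton disjnt_insert1 disjnt_empty1 singletonD)
    \<comment> \<open>The Urysohn function \<open>g\<close> only shows that some pair of basic sets
      around \<open>x\<close> and \<open>y\<close> is an index. The coordinate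
      \<open>f (V, W)\<close> chosen for this pair may differ from \<open>g\<close>, but it
      separates \<open>x\<close> from \<open>y\<close> as well.\<close>
    have "openin X {z \<in> topspace X. g z < 1/2}" "openin X {z \<in> topspace X. g z > 1/2}"
      using g(1) unfolding continuous_map_upper_lower_semicontinuous_lt by blast+
    moreover have "x \<in> {z \<in> topspace X. g z < 1/2}" "y \<in> {z \<in> topspace X. g z > 1/2}"
      using xy g by auto
    ultimately obtain V W where VW: "V \<in> \<B>" "x \<in> V" "V \<subseteq> {z \<in> topspace X. g z < 1/2}"
      "W \<in> \<B>" "y \<in> W" "W \<subseteq> {z \<in> topspace X. g z > 1/2}"
      using \<B>(3) by meson
    then have "sep (V, W) g"
      using g(1) by (auto simp: sep_def)
    then have I: "(V, W) \<in> I"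
      using VW by (auto simp: I_def)
    then have "f (V, W) x = f (V, W) y"
      using fun_cong[OF xy(3), of "(V, W)"] by (simp add: F_def)
    moreover have "f (V, W) x < 1/2" "f (V, W) y > 1/2"
      using f[OF I] VW by (auto simp: sep_def)
    ultimately show False by simp
  qed
  have "metrizable_space ?Y"
    unfolding metrizable_space_product_topology
    using \<B>(1) by (auto simp: I_def metrizable_space_euclidean intro: countable_subset[of _ "\<B> \<times> \<B>"])
  moreover from this have "closed_map X ?Y F"
    by (intro continuous_imp_closed_map assms cont metrizable_imp_Hausdorff_space)
  ultimately show ?thesis
    using injective_closed_imp_embedding_map[OF cont _ inj]
    by (metis embedding_map_imp_homeomorphic_space homeomorphic_metrizable_space metrizable_space_subtopology)
qed

text \<open>Induction on the walk. When the new endpoint already lies on the path, the path is cut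
  off there, which keeps its vertices distinct.\<close>

lemma rtrancl_imp_distinct_path:
  assumes "(x, y) \<in> r\<^sup>*"
  shows "\<exists>xs. xs \<noteq> [] \<and> hd xs = x \<and> last xs = y \<and> distinct xs \<and> successively (\<lambda>u v. (u, v) \<in> r) xs"
  using assms
proof induction
  case base
  show ?case by (intro exI[of _ "[x]"]) auto
next
  case (step y z)
  then obtain xs where xs: "xs \<noteq> []" "hd xs = x" "last xs = y" "distinct xs"
    "successively (\<lambda>u v. (u, v) \<in> r) xs"
    by blast
  show ?case
  proof (cases "z \<in> set xs")
    case True
    then obtain us vs where "xs = (us @ [z]) @ vs"
      by (metis append.assoc append_Cons append_Nil split_list)
    with xs show ?thesis
      by (intro exI[of _ "us @ [z]"]) (auto simp: successively_append_iff hd_append)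
  next
    case False
    with xs step.hyps show ?thesis
      by (intro exI[of _ "xs @ [z]"]) (auto simp: successively_append_iff)
  qed
qed

text \<open>The length bound excludes singleton lists, which satisfy \<open>successively\<close>
  vacuously.\<close>

lemma successively_set_subset_Field:
  assumes "successively (\<lambda>u v. (u, v) \<in> r) xs" "length xs \<ge> 2"
  shows "set xs \<subseteq> Field r"
  using assms
proof (induction xs)
  case (Cons x xs)
  then show ?case
    by (cases xs; cases "tl xs") (auto simp: Field_def)
qed simp

text \<open>\<open>A\<close> is the component of \<open>g\<close> after the edge has been removed.
  If \<open>h\<close> were still reachable, a path of distinct vertices from \<open>g\<close> to
  \<open>h\<close>, closed up by the removed edge, would be a cycle.\<close>

lemma tree_edge_split:
  assumes "tree T" and e: "(g, h) \<in> adj T" "g \<noteq> h"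
  obtains A B where "A \<union> B = verts T" "A \<inter> B = {}" "g \<in> A" "h \<in> B"
    "\<And>a b. a \<in> A \<Longrightarrow> b \<in> B \<Longrightarrow> (a, b) \<in> adj T \<Longrightarrow> a = g \<and> b = h"
proof -
  have T: "adj T \<subseteq> verts T \<times> verts T" "sym (adj T)" and nocyc: "\<nexists>xs. gcycle T xs"
    using assms by (auto simp: tree_def graph_def)
  define r where "r = adj T - {(g, h), (h, g)}"
  define A where "A = {x \<in> verts T. (g, x) \<in> r\<^sup>*}"
  have "h \<notin> A"
  proof
    assume "h \<in> A"
    then obtain xs where xs: "xs \<noteq> []" "hd xs = g" "last xs = h" "distinct xs"
      "successively (\<lambda>u v. (u, v) \<in> r) xs"
      using rtrancl_imp_distinct_path[of g h r] by (auto simp: A_def)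
    \<comment> \<open>One vertex would force \<open>g = h\<close>, and two vertices would use the
      removed edge.\<close>
    have len: "length xs \<ge> 3"
    proof (rule ccontr)
      assume "\<not> length xs \<ge> 3"
      then consider "length xs = 1" | "length xs = 2"
        using xs(1) by (cases "length xs") (auto simp: not_le less_Suc_eq numeral_eq_Suc)
      then show False
        using xs e by cases (auto simp: length_Suc_conv numeral_2_eq_2 r_def)
    qed
    have "set xs \<subseteq> Field r"
      using successively_set_subset_Field[OF xs(5)] len by simp
    then have "set xs \<subseteq> verts T"
      using T by (auto simp: r_def Field_def)
    moreover have "successively (\<lambda>u v. (u, v) \<in> adj T) xs"
      using xs(5) by (rule successively_mono) (auto simp: r_def)
    moreover have "(last xs, hd xs) \<in> adj T"
      using xs e T by (auto dest: symD)
    ultimately show False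
      using nocyc xs len by (auto simp: gcycle_def)
  qed
  show ?thesis
  proof
    show "A \<union> (verts T - A) = verts T" "A \<inter> (verts T - A) = {}" "g \<in> A" "h \<in> verts T - A"
      using T e \<open>h \<notin> A\<close> by (auto simp: A_def)
    fix a b assume ab: "a \<in> A" "b \<in> verts T - A" "(a, b) \<in> adj T"
    then have "(a, b) \<notin> r"
      by (auto simp: A_def dest: rtrancl_into_rtrancl)
    with ab \<open>h \<notin> A\<close> show "a = g \<and> b = h"
      by (auto simp: r_def)
  qed
qed

lemma gconnected_split:
  assumes "gconnected T C" "A \<union> B = C" "A \<inter> B = {}" "A \<noteq> {}" "B \<noteq> {}"
  obtains a b where "a \<in> A" "b \<in> B" "(a, b) \<in> adj T"
  using assms unfolding gconnected_def by metis

text \<open>Serves to carry the tree property from a level to the overlap graph of its basic open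
  sets. Separations and cycles of \<open>H\<close> are pulled back to \<open>T\<close> along the
  inverse \<open>g\<close>.\<close>

lemma tree_bij_betw:
  fixes T :: "'a rgraph" and H :: "'b rgraph"
  assumes "tree T" and bij: "bij_betw f (verts T) (verts H)"
    and adj: "\<And>x y. x \<in> verts T \<Longrightarrow> y \<in> verts T \<Longrightarrow> (f x, f y) \<in> adj H \<longleftrightarrow> (x, y) \<in> adj T"
    and sub: "adj H \<subseteq> verts H \<times> verts H"
  shows "tree H"
proof -
  define g where "g = the_inv_into (verts T) f"
  have gf: "g (f x) = x" if "x \<in> verts T" for x
    using that bij by (simp add: g_def bij_betw_def the_inv_into_f_f)
  have fg: "f (g y) = y" and gv: "g y \<in> verts T" if "y \<in> verts H" for y
  proof -
    have "y \<in> f ` verts T" using that bij_betw_imp_surj_on[OF bij] by simp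
    then obtain x where "x \<in> verts T" "y = f x" by (rule imageE)
    with gf show "f (g y) = y" "g y \<in> verts T" by simp_all
  qed
  have T: "graph T" "gconnected T (verts T)" and nocyc: "\<And>xs. \<not> gcycle T xs"
    using assms(1) by (auto simp: tree_def)
  have adjg: "(x, y) \<in> adj H \<longleftrightarrow> (g x, g y) \<in> adj T" if "x \<in> verts H" "y \<in> verts H" for x y
    using adj[OF gv gv, OF that] fg that by simp
  have "graph H"
    unfolding graph_def
  proof (intro conjI sub)
    show "finite (verts H)"
      using T(1) bij bij_betw_finite by (auto simp: graph_def)
    show "verts H \<noteq> {}"
      using T(1) bij by (auto simp: graph_def bij_betw_def)
    show "refl_on (verts H) (adj H)"
      using T(1) adjg gv by (auto simp: graph_def refl_on_def)
    show "sym (adj H)"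
    proof (rule symI)
      fix x y assume xy: "(x, y) \<in> adj H"
      with sub have "x \<in> verts H" "y \<in> verts H" by auto
      with xy show "(y, x) \<in> adj H"
        using adjg[of x y] adjg[of y x] T(1) by (auto simp: graph_def dest: symD)
    qed
  qed
  moreover have "gconnected H (verts H)"
    unfolding gconnected_def
  proof (intro conjI notI order_refl, elim exE conjE)
    fix A B assume AB: "A \<noteq> {}" "B \<noteq> {}" "A \<union> B = verts H" "A \<inter> B = {}"
      "\<forall>a\<in>A. \<forall>b\<in>B. (a, b) \<notin> adj H"
    have "g ` A \<union> g ` B = verts T"
      unfolding image_Un[symmetric] AB(3) bij_betw_imp_surj_on[OF bij, symmetric] image_image
      using gf by simp
    moreover have "g ` A \<inter> g ` B = {}"
    proof (rule equals0I)
      fix z assume "z \<in> g ` A \<inter> g ` B"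
      then obtain a b where ab: "a \<in> A" "b \<in> B" "z = g a" "z = g b" by blast
      with AB(3) fg have "a = b" by (metis UnCI)
      with ab AB(4) show False by blast
    qed
    ultimately obtain x y where "x \<in> g ` A" "y \<in> g ` B" "(x, y) \<in> adj T"
      using gconnected_split[OF T(2)] AB(1,2) by (metis image_is_empty)
    then obtain a b where "a \<in> A" "b \<in> B" "(g a, g b) \<in> adj T" by blast
    with AB(3,5) adjg[of a b] show False by blast
  qed
  moreover have "\<not> gcycle H xs" for xs
  proof
    assume H: "gcycle H xs"
    then have xs: "set xs \<subseteq> verts H" "xs \<noteq> []" by (auto simp: gcycle_def)
    have "inj_on g (set xs)"
      using xs(1) fg by (metis inj_onI subsetD)
    moreover have "successively (\<lambda>x y. (g x, g y) \<in> adj T) xs"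
      by (rule successively_mono[of "\<lambda>x y. (x, y) \<in> adj H"])
        (use H xs adjg in \<open>auto simp: gcycle_def\<close>)
    moreover have "last xs \<in> verts H" "hd xs \<in> verts H"
      using xs last_in_set hd_in_set by blast+
    ultimately have "gcycle T (map g xs)"
      using H gv xs adjg[of "last xs" "hd xs"]
      by (auto simp: gcycle_def distinct_map successively_map last_map hd_map)
    with nocyc show False by blast
  qed
  ultimately show ?thesis by (simp add: tree_def)
qed

section \<open>Extracting subsequences\<close>

lemma strict_mono_cofinal:
  obtains \<phi> :: "nat \<Rightarrow> nat" where "strict_mono \<phi>" "\<And>i j. i < j \<Longrightarrow> N (\<phi> i) \<le> \<phi> j"
proof -
  define \<phi> where "\<phi> = rec_nat 0 (\<lambda>_ k. Suc (max k (N k)))"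
  have Suc: "\<phi> (Suc i) = Suc (max (\<phi> i) (N (\<phi> i)))" for i by (simp add: \<phi>_def)
  then have mono: "strict_mono \<phi>" by (simp add: strict_mono_Suc_iff less_Suc_eq_le)
  have "N (\<phi> i) \<le> \<phi> j" if "i < j" for i j
  proof -
    have "\<phi> (Suc i) \<le> \<phi> j"
      using that by (simp add: strict_mono_less_eq[OF mono])
    with Suc[of i] show ?thesis by simp
  qed
  with mono that show thesis by blast
qed

text \<open>Each next index is chosen beyond the threshold of the previous one; by monotonicity it
  then serves all later indices too.\<close>

lemma has_subseq_withI:
  assumes "\<And>m. \<exists>N. \<forall>n\<ge>N. m \<le> n \<longrightarrow> Q (G n) (G m) (R m n)"
  shows "has_subseq_with Q G R"
proof -
  obtain N where N: "\<And>m n. n \<ge> N m \<Longrightarrow> m \<le> n \<Longrightarrow> Q (G n) (G m) (R m n)"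
    using assms by metis
  obtain \<phi> :: "nat \<Rightarrow> nat" where \<phi>: "strict_mono \<phi>" "\<And>i j. i < j \<Longrightarrow> N (\<phi> i) \<le> \<phi> j"
    using strict_mono_cofinal[of N] by metis
  have "Q (G (\<phi> j)) (G (\<phi> i)) (R (\<phi> i) (\<phi> j))" if "i < j" for i j
    using N \<phi>(2)[OF that] strict_monoD[OF \<phi>(1) that] by simp
  with \<phi>(1) show ?thesis
    unfolding has_subseq_with_def seq_has_def by blast
qed

lemma has_subseq_withE:
  assumes "has_subseq_with Q G R"
  obtains m m' where "n \<le> m" "m < m'" "Q (G m') (G m) (R m m')"
proof -
  obtain \<phi> :: "nat \<Rightarrow> nat" where \<phi>: "strict_mono \<phi>" "\<And>i j. i < j \<Longrightarrow> Q (G (\<phi> j)) (G (\<phi> i)) (R (\<phi> i) (\<phi> j))"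
    using assms unfolding has_subseq_with_def seq_has_def by blast
  show thesis
    using that[of "\<phi> n" "\<phi> (Suc n)"] \<phi> strict_mono_imp_increasing[OF \<phi>(1)]
    by (simp add: strict_mono_less[OF \<phi>(1)])
qed

subsection \<open>The induced poset and its spectrum\<close>

locale B_seq =
  fixes G :: "nat \<Rightarrow> 'a rgraph" and R :: "nat \<Rightarrow> nat \<Rightarrow> ('a \<times> 'a) set"
  assumes B_sequence: "B_sequence G R"
begin

abbreviation P where "P \<equiv> induced_carrier G"
abbreviation r where "r \<equiv> induced_order G R"
abbreviation le (infix "\<preceq>" 50) where "p \<preceq> q \<equiv> (p, q) \<in> r"
abbreviation points where "points \<equiv> spectrum_points P r"
abbreviation SP where "SP \<equiv> spectrum P r"

section \<open>Levels, order and edges of the induced poset\<close>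

definition level where "level n = Pair n ` verts (G n)"

text \<open>The edge relations of all graphs, moved to tagged vertices, so that the later arguments
  can stay inside the poset.\<close>

definition nbr where "nbr p q \<longleftrightarrow> fst p = fst q \<and> (snd p, snd q) \<in> adj (G (fst p))"

text \<open>The subbasic open set \<open>p\<^sup>\<in>\<close> of the spectrum. By
  \<open>openin_SP_iff\<close> these sets even form a base.\<close>

definition basic where "basic p = {S \<in> points. p \<in> S}"

lemma morphism: "m \<le> n \<Longrightarrow> B_morphism (G n) (G m) (R m n)"
  and R_refl: "R n n = Id_on (verts (G n))"
  and R_comp: "l \<le> m \<Longrightarrow> m \<le> n \<Longrightarrow> R l m O R m n = R l n"
  using B_sequence by (simp_all add: B_sequence_def)

lemma graph_G: "graph (G n)"
  using morphism[of n n] by (simp add: B_morphism_def)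

lemma finite_level: "finite (level n)" and level_ne: "level n \<noteq> {}"
  using graph_G[of n] by (auto simp: level_def graph_def)

lemma level_iff: "p \<in> level n \<longleftrightarrow> p \<in> P \<and> fst p = n"
  by (cases p) (auto simp: level_def induced_carrier_def)

lemma le_iff: "(n, p) \<preceq> (m, q) \<longleftrightarrow> m \<le> n \<and> (q, p) \<in> R m n"
  using morphism[of m n] by (auto simp: induced_order_def B_morphism_def)

lemma leD: "p \<preceq> q \<Longrightarrow> p \<in> P" "p \<preceq> q \<Longrightarrow> q \<in> P" "p \<preceq> q \<Longrightarrow> fst q \<le> fst p"
  by (auto simp: induced_order_def induced_carrier_def)

lemma le_refl: "p \<in> P \<Longrightarrow> p \<preceq> p"
  by (cases p) (auto simp: le_iff R_refl induced_carrier_def)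

lemma le_trans: "p \<preceq> q \<Longrightarrow> q \<preceq> s \<Longrightarrow> p \<preceq> s"
proof -
  assume pqs: "p \<preceq> q" "q \<preceq> s"
  obtain n x m y k z where [simp]: "p = (n, x)" "q = (m, y)" "s = (k, z)" by (metis surj_pair)
  have "k \<le> m" "m \<le> n" "(z, x) \<in> R k m O R m n" using pqs by (auto simp: le_iff)
  then show "p \<preceq> s" using R_comp[of k m n] by (simp add: le_iff)
qed

lemma le_same_level: "p \<preceq> q \<Longrightarrow> fst p = fst q \<Longrightarrow> p = q"
  by (cases p; cases q) (auto simp: le_iff R_refl)

text \<open>This is the composition law of the sequence, read in the poset.\<close>

lemma le_interpolate:
  assumes "p \<preceq> q" "fst q \<le> m" "m \<le> fst p"
  obtains s where "s \<in> level m" "p \<preceq> s" "s \<preceq> q"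
proof -
  obtain n x k y where pq: "p = (n, x)" "q = (k, y)" by (metis surj_pair)
  then have "(y, x) \<in> R k m O R m n"
    using assms R_comp[of k m n] by (simp add: le_iff)
  then obtain z where "(y, z) \<in> R k m" "(z, x) \<in> R m n" by auto
  with pq assms have "p \<preceq> (m, z)" "(m, z) \<preceq> q" by (simp_all add: le_iff)
  moreover from this have "(m, z) \<in> level m" using leD(1) by (simp add: level_iff)
  ultimately show thesis using that by blast
qed

text \<open>The first half of co-bijectivity: images of vertices are non-empty.\<close>

lemma ex_above:
  assumes "p \<in> P" "m \<le> fst p"
  obtains q where "q \<in> level m" "p \<preceq> q"
proof -
  obtain n x where p: "p = (n, x)" by (metis surj_pair)
  with assms have "(R m n)\<inverse> `` {x} \<noteq> {}"
    using morphism[of m n] by (auto simp: B_morphism_def co_bijective_def induced_carrier_def)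
  then obtain y where "(y, x) \<in> R m n" by auto
  with p assms have le: "p \<preceq> (m, y)" by (simp add: le_iff)
  then have "(m, y) \<in> level m" using leD(2) by (simp add: level_iff)
  from that[OF this le] show thesis .
qed

text \<open>The second half of co-bijectivity: every vertex is the whole image of some vertex. This
  is what later yields points meeting a level in one prescribed vertex only.\<close>

lemma ex_exactly_below:
  assumes "p \<in> P" "fst p \<le> n"
  obtains q where "q \<in> level n" "q \<preceq> p" "\<And>s. s \<in> level (fst p) \<Longrightarrow> q \<preceq> s \<Longrightarrow> s = p"
proof -
  obtain m x where p: "p = (m, x)" by (metis surj_pair)
  have "co_bijective (G n) (G m) (R m n)"
    using p assms(2) morphism[of m n] by (simp add: B_morphism_def)
  then obtain y where "(R m n)\<inverse> `` {y} = {x}"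
    using p assms(1) unfolding co_bijective_def induced_carrier_def by blast
  then have xy: "(x, y) \<in> R m n" "\<And>z. (z, y) \<in> R m n \<Longrightarrow> z = x" by blast+
  have le: "(n, y) \<preceq> p" using xy(1) p assms(2) by (simp add: le_iff)
  then have "(n, y) \<in> level n" using leD(1) by (simp add: level_iff)
  moreover have "s = p" if "s \<in> level (fst p)" "(n, y) \<preceq> s" for s
    using that p xy(2) by (cases s) (simp add: le_iff level_iff)
  ultimately show thesis using that[of "(n, y)"] le by blast
qed

lemma nbr_refl: "p \<in> P \<Longrightarrow> nbr p p"
  using graph_G by (cases p) (auto simp: nbr_def graph_def refl_on_def induced_carrier_def)

lemma nbr_sym: "nbr p q \<Longrightarrow> nbr q p"
  using graph_G[of "fst q"] by (auto simp: nbr_def graph_def dest: symD)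

lemma nbrD: "nbr p q \<Longrightarrow> p \<in> P" "nbr p q \<Longrightarrow> q \<in> P" "nbr p q \<Longrightarrow> fst p = fst q"
proof -
  have "adj (G n) \<subseteq> verts (G n) \<times> verts (G n)" for n
    using graph_G by (simp add: graph_def)
  then show "nbr p q \<Longrightarrow> p \<in> P" "nbr p q \<Longrightarrow> q \<in> P" "nbr p q \<Longrightarrow> fst p = fst q"
    unfolding nbr_def induced_carrier_def by (cases p; cases q; force)+
qed

lemma nbr_above: "nbr p q \<Longrightarrow> p \<preceq> p' \<Longrightarrow> q \<preceq> q' \<Longrightarrow> fst p' = fst q' \<Longrightarrow> nbr p' q'"
proof -
  assume pq: "nbr p q" and le: "p \<preceq> p'" "q \<preceq> q'" "fst p' = fst q'"
  obtain n x y m x' y' where [simp]: "p = (n, x)" "q = (n, y)" "p' = (m, x')" "q' = (m, y')"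
    using pq le(3) by (metis nbr_def prod.collapse)
  have "edge_preserving (G n) (G m) (R m n)"
    using le morphism[of m n] by (simp add: le_iff B_morphism_def)
  then show "nbr p' q'"
    using pq le unfolding edge_preserving_def nbr_def by (simp add: le_iff) blast
qed

text \<open>Edge preservation applied to the loop at \<open>p\<close>. It is the half of
  edge-faithfulness that holds in every sequence.\<close>

lemma common_lower_bound_imp_nbr: "p \<preceq> q \<Longrightarrow> p \<preceq> q' \<Longrightarrow> fst q = fst q' \<Longrightarrow> nbr q q'"
  using nbr_above nbr_refl leD(1) by blast

section \<open>Caps, selectors and the existence of minimal selectors\<close>

lemma refines_deeper:
  assumes "\<forall>g\<in>level m. \<exists>c\<in>C. g \<preceq> c" "m \<le> n" "g \<in> level n"
  shows "\<exists>c\<in>C. g \<preceq> c"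
proof -
  obtain q where "q \<in> level m" "g \<preceq> q"
    using ex_above[of g m] assms(2,3) by (auto simp: level_iff)
  with assms(1) le_trans show ?thesis by blast
qed

lemma band_level: "band P r (level n)"
  unfolding band_def
proof (intro conjI ballI)
  fix p assume p: "p \<in> P"
  show "\<exists>b\<in>level n. p \<preceq> b \<or> b \<preceq> p"
  proof (cases "n \<le> fst p")
    case True
    with ex_above[OF p] show ?thesis by metis
  next
    case False
    with ex_exactly_below[OF p, of n] show ?thesis by (metis nat_le_linear)
  qed
qed (auto simp: finite_level level_iff)

text \<open>A band is refined by the level at its maximal depth: a vertex of that level which is
  comparable to a member of the band must lie below it. Conversely, each level is itself a
  band.\<close>

lemma cap_iff: "cap P r C \<longleftrightarrow> C \<subseteq> P \<and> (\<exists>n. \<forall>g\<in>level n. \<exists>c\<in>C. g \<preceq> c)"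
proof
  assume "cap P r C"
  then obtain B where B: "C \<subseteq> P" "finite B" "B \<subseteq> P" "\<And>p. p \<in> P \<Longrightarrow> \<exists>b\<in>B. p \<preceq> b \<or> b \<preceq> p"
    "\<And>b. b \<in> B \<Longrightarrow> \<exists>c\<in>C. b \<preceq> c"
    unfolding cap_def band_def by blast
  define n where "n = Max (fst ` B)"
  have "\<exists>c\<in>C. g \<preceq> c" if g: "g \<in> level n" for g
  proof -
    have "g \<in> P" using g by (simp add: level_iff)
    then obtain b where b: "b \<in> B" "g \<preceq> b \<or> b \<preceq> g"
      using B(4) by blast
    then have "fst b \<le> n" using B(2) by (auto simp: n_def)
    then have "g \<preceq> b"
      using b(2) g le_same_level[of b g] leD(3)[of b g] le_refl by (auto simp: level_iff)
    with b B(5) le_trans show ?thesis by blast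
  qed
  with B(1) show "C \<subseteq> P \<and> (\<exists>n. \<forall>g\<in>level n. \<exists>c\<in>C. g \<preceq> c)" by blast
next
  assume "C \<subseteq> P \<and> (\<exists>n. \<forall>g\<in>level n. \<exists>c\<in>C. g \<preceq> c)"
  then show "cap P r C"
    unfolding cap_def using band_level by blast
qed

text \<open>A set missed by \<open>S\<close> lies in the complement of \<open>S\<close>, and a
  subset of \<open>P\<close> containing a cap is a cap.\<close>

lemma selector_iff_not_cap: "selector P r S \<longleftrightarrow> S \<subseteq> P \<and> \<not> cap P r (P - S)"
proof
  assume "selector P r S"
  then show "S \<subseteq> P \<and> \<not> cap P r (P - S)"
    unfolding selector_def by blast
next
  assume S: "S \<subseteq> P \<and> \<not> cap P r (P - S)"
  show "selector P r S"
    unfolding selector_def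
  proof (intro conjI allI impI notI)
    fix C assume "cap P r C" "S \<inter> C = {}"
    then have "cap P r (P - S)"
      unfolding cap_iff by (blast dest: leD(2))
    with S show False by blast
  qed (use S in blast)
qed

lemma selector_iff:
  "selector P r S \<longleftrightarrow> S \<subseteq> P \<and> (\<forall>n. \<exists>g\<in>level n. \<forall>q. g \<preceq> q \<longrightarrow> q \<in> S)"
  unfolding selector_iff_not_cap cap_iff using leD(2) by blast

lemma upset_selector:
  assumes "S \<subseteq> P" "\<And>n. S \<inter> level n \<noteq> {}" "\<And>p q. p \<in> S \<Longrightarrow> p \<preceq> q \<Longrightarrow> q \<in> S"
  shows "selector P r S"
  unfolding selector_iff
proof (intro conjI allI)
  fix n
  obtain g where "g \<in> S" "g \<in> level n" using assms(2)[of n] by blast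
  with assms(3) show "\<exists>g\<in>level n. \<forall>q. g \<preceq> q \<longrightarrow> q \<in> S" by blast
qed (fact assms(1))

text \<open>Minimal selectors are the complements of maximal non-caps, and Zorn's lemma provides the
  latter. The union of a chain of non-caps is no cap: since levels are finite, finitely many of its
  elements would already refine some level, and these lie in a single member of the chain.\<close>

lemma ex_point_subset:
  assumes "selector P r S"
  obtains T where "T \<in> points" "T \<subseteq> S"
proof -
  define \<A> where "\<A> = {A. P - S \<subseteq> A \<and> A \<subseteq> P \<and> \<not> cap P r A}"
  have "\<exists>M\<in>\<A>. \<forall>A\<in>\<A>. M \<subseteq> A \<longrightarrow> A = M"
  proof (rule subset_Zorn_nonempty)
    have "P - S \<in> \<A>"
      using assms by (simp add: selector_iff_not_cap \<A>_def)
    then show "\<A> \<noteq> {}" by blast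
    fix \<C> assume \<C>: "\<C> \<noteq> {}" "subset.chain \<A> \<C>"
    then have sub: "\<C> \<subseteq> \<A>" unfolding subset_chain_def by simp
    have "\<not> cap P r (\<Union>\<C>)"
    proof
      assume "cap P r (\<Union>\<C>)"
      then obtain n where "\<forall>g\<in>level n. \<exists>c\<in>\<Union>\<C>. g \<preceq> c"
        unfolding cap_iff by (elim conjE exE)
      then obtain c where c: "\<forall>g\<in>level n. c g \<in> \<Union>\<C> \<and> g \<preceq> c g"
        unfolding Bex_def by (elim bchoice[elim_format] exE)
      then have "c ` level n \<subseteq> \<Union>\<C>" by blast
      then obtain B where B: "B \<in> \<C>" "c ` level n \<subseteq> B"
        using finite_subset_Union_chain[OF finite_imageI[OF finite_level] _ \<C>] by blast
      with sub have "B \<subseteq> P" "\<not> cap P r B" by (auto simp: \<A>_def)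
      moreover have "\<forall>g\<in>level n. \<exists>c\<in>B. g \<preceq> c"
        using B(2) c by blast
      ultimately show False unfolding cap_iff by blast
    qed
    with \<C>(1) sub show "\<Union>\<C> \<in> \<A>"
      unfolding \<A>_def by blast
  qed
  then obtain M where M: "M \<in> \<A>" "\<And>A. A \<in> \<A> \<Longrightarrow> M \<subseteq> A \<Longrightarrow> A = M" by blast
  have "P - M \<in> points"
    unfolding spectrum_points_def
  proof (intro CollectI conjI allI impI)
    have "P - (P - M) = M" using M(1) by (auto simp: \<A>_def)
    with M(1) show "selector P r (P - M)"
      by (auto simp: selector_iff_not_cap \<A>_def)
    fix T assume T: "selector P r T \<and> T \<subseteq> P - M"
    then have "P - T \<in> \<A>" "M \<subseteq> P - T"
      using M(1) unfolding selector_iff_not_cap \<A>_def by blast+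
    with M(2) have "P - T = M" by blast
    with T show "T = P - M"
      unfolding selector_iff_not_cap by blast
  qed
  moreover have "P - M \<subseteq> S" using M(1) by (auto simp: \<A>_def)
  ultimately show thesis using that by blast
qed

section \<open>Points of the spectrum as filters\<close>

lemma point_subset: "S \<in> points \<Longrightarrow> S \<subseteq> P"
  and point_selector: "S \<in> points \<Longrightarrow> selector P r S"
  and point_minimal: "S \<in> points \<Longrightarrow> selector P r T \<Longrightarrow> T \<subseteq> S \<Longrightarrow> T = S"
  by (auto simp: spectrum_points_def selector_def)

lemma point_level: "S \<in> points \<Longrightarrow> \<exists>g\<in>level n. g \<in> S"
proof -
  assume "S \<in> points"
  then obtain g where "g \<in> level n" "\<And>q. g \<preceq> q \<Longrightarrow> q \<in> S"
    using point_selector unfolding selector_iff by blast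
  then show ?thesis using le_refl level_iff by blast
qed

text \<open>The elements of \<open>S\<close> whose whole up-set lies in \<open>S\<close> still form
  a selector, so by minimality they are all of \<open>S\<close>.\<close>

lemma point_upset:
  assumes S: "S \<in> points" and "p \<in> S" "p \<preceq> q"
  shows "q \<in> S"
proof -
  have "selector P r {s \<in> S. \<forall>t. s \<preceq> t \<longrightarrow> t \<in> S}" (is "selector P r ?T")
    unfolding selector_iff
  proof (intro conjI allI)
    show "?T \<subseteq> P" using point_subset[OF S] by blast
    fix n
    obtain g where g: "g \<in> level n" "\<And>q. g \<preceq> q \<Longrightarrow> q \<in> S"
      using point_selector[OF S] unfolding selector_iff by blast
    then show "\<exists>g\<in>level n. \<forall>q. g \<preceq> q \<longrightarrow> q \<in> ?T"
      using le_trans by blast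
  qed
  then have "?T = S" using point_minimal[OF S] by blast
  with assms show ?thesis by blast
qed

text \<open>By minimality \<open>S - {s}\<close> is no selector, so at some level \<open>n\<close>
  every vertex has an element above it outside \<open>S - {s}\<close>. Above a vertex of
  \<open>S\<close> that element belongs to \<open>S\<close> by up-closure, hence is
  \<open>s\<close>.\<close>

lemma point_eventually_below:
  assumes S: "S \<in> points" and s: "s \<in> S"
  obtains n where "\<And>m g. m \<ge> n \<Longrightarrow> g \<in> S \<Longrightarrow> g \<in> level m \<Longrightarrow> g \<preceq> s"
proof -
  have "\<not> selector P r (S - {s})"
    using point_minimal[OF S, of "S - {s}"] s by blast
  then obtain n where n: "\<And>g. g \<in> level n \<Longrightarrow> \<exists>q. g \<preceq> q \<and> q \<notin> S - {s}"
    using point_subset[OF S] unfolding selector_iff by blast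
  have "g \<preceq> s" if "m \<ge> n" "g \<in> S" "g \<in> level m" for m g
  proof -
    have "g \<in> P" "n \<le> fst g" using that by (simp_all add: level_iff)
    then obtain g' where g': "g' \<in> level n" "g \<preceq> g'" using ex_above by blast
    with n obtain q where q: "g' \<preceq> q" "q \<notin> S - {s}" by blast
    have "q \<in> S" using point_upset[OF S] that(2) g'(2) q(1) by blast
    with q g' show ?thesis using le_trans by blast
  qed
  with that show thesis by blast
qed

lemma point_filter:
  assumes S: "S \<in> points" and "s \<in> S" "t \<in> S"
  obtains n where "\<And>m g. m \<ge> n \<Longrightarrow> g \<in> S \<Longrightarrow> g \<in> level m \<Longrightarrow> g \<preceq> s \<and> g \<preceq> t"
proof -
  obtain k where k: "\<And>m g. m \<ge> k \<Longrightarrow> g \<in> S \<Longrightarrow> g \<in> level m \<Longrightarrow> g \<preceq> s"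
    using point_eventually_below[OF S assms(2)] by blast
  obtain l where l: "\<And>m g. m \<ge> l \<Longrightarrow> g \<in> S \<Longrightarrow> g \<in> level m \<Longrightarrow> g \<preceq> t"
    using point_eventually_below[OF S assms(3)] by blast
  show thesis
  proof (rule that)
    fix m g assume "m \<ge> max k l" "g \<in> S" "g \<in> level m"
    with k[of m g] l[of m g] show "g \<preceq> s \<and> g \<preceq> t" by simp
  qed
qed

lemma point_common_lower_bound:
  assumes S: "S \<in> points" and "s \<in> S" "t \<in> S"
  obtains g where "g \<in> S" "g \<preceq> s" "g \<preceq> t"
  using point_filter[OF assms] point_level[OF S] by (metis order_refl)

text \<open>A sufficiently deep vertex of \<open>S\<close> lies below \<open>p\<close>.
  Interpolating at level \<open>m\<close> and using up-closure brings it back to the required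
  depth.\<close>

lemma point_below_at_level:
  assumes S: "S \<in> points" and p: "p \<in> S" "fst p \<le> m"
  obtains g where "g \<in> S" "g \<in> level m" "g \<preceq> p"
proof -
  obtain n where n: "\<And>k g. k \<ge> n \<Longrightarrow> g \<in> S \<Longrightarrow> g \<in> level k \<Longrightarrow> g \<preceq> p"
    using point_eventually_below[OF S p(1)] by blast
  obtain g where g: "g \<in> S" "g \<in> level (max m n)"
    using point_level[OF S] by blast
  then have "g \<preceq> p" using n[of "max m n" g] by simp
  moreover have "m \<le> fst g" using g by (simp add: level_iff)
  ultimately obtain s where "s \<in> level m" "g \<preceq> s" "s \<preceq> p"
    using le_interpolate p(2) by metis
  with that g point_upset[OF S] show thesis by blast
qed

text \<open>The rest of the level is not a cap, because at every later depth some vertex has only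
  \<open>p\<close> above it in this level. So the complement of that rest is a selector and contains
  a point.\<close>

lemma ex_point_exactly:
  assumes "p \<in> P"
  obtains S where "S \<in> points" "S \<inter> level (fst p) = {p}"
proof -
  have "\<not> cap P r (level (fst p) - {p})"
  proof
    assume "cap P r (level (fst p) - {p})"
    then obtain n where n: "\<forall>g\<in>level n. \<exists>c\<in>level (fst p) - {p}. g \<preceq> c"
      unfolding cap_iff by blast
    obtain g where "g \<in> level (max n (fst p))" "\<And>s. s \<in> level (fst p) \<Longrightarrow> g \<preceq> s \<Longrightarrow> s = p"
      using ex_exactly_below[OF assms max.cobounded2[of "fst p" n]] by metis
    with refines_deeper[OF n max.cobounded1 this(1)] show False by blast
  qed
  moreover have "P - (P - (level (fst p) - {p})) = level (fst p) - {p}"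
    by (auto simp: level_iff)
  ultimately have "selector P r (P - (level (fst p) - {p}))"
    unfolding selector_iff_not_cap by auto
  then obtain S where S: "S \<in> points" "S \<subseteq> P - (level (fst p) - {p})"
    using ex_point_subset by blast
  moreover have "\<exists>g\<in>level (fst p). g \<in> S" using point_level S by blast
  ultimately show thesis using that[of S] by blast
qed

section \<open>Basic open sets and the topology of the spectrum\<close>

lemma basic_nonempty: "p \<in> P \<Longrightarrow> basic p \<noteq> {}"
  using ex_point_exactly[of p] unfolding basic_def by blast

lemma basic_mono: "p \<preceq> q \<Longrightarrow> basic p \<subseteq> basic q"
  using point_upset unfolding basic_def by blast

text \<open>Needed because the vertices of an overlap graph are the sets themselves, so that
  different vertices of a level must not give the same set.\<close>

lemma basic_inj_on_level: "inj_on basic (level n)"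
proof (rule inj_onI)
  fix p q assume pq: "p \<in> level n" "q \<in> level n" "basic p = basic q"
  then have "p \<in> P" "fst p = n" by (simp_all add: level_iff)
  then obtain S where S: "S \<in> points" "S \<inter> level n = {p}"
    using ex_point_exactly by metis
  then have "S \<in> basic p" by (auto simp: basic_def)
  then have "q \<in> S \<inter> level n" using pq by (auto simp: basic_def)
  with S show "p = q" by simp
qed

text \<open>Forwards, a common point is a filter; backwards, a common lower bound has a non-empty
  basic set.\<close>

lemma basic_Int_nonempty_iff:
  "basic p \<inter> basic q \<noteq> {} \<longleftrightarrow> (\<exists>s. s \<preceq> p \<and> s \<preceq> q)"
proof
  assume "basic p \<inter> basic q \<noteq> {}"
  then show "\<exists>s. s \<preceq> p \<and> s \<preceq> q"
    unfolding basic_def using point_common_lower_bound by blast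
next
  assume "\<exists>s. s \<preceq> p \<and> s \<preceq> q"
  then obtain s where s: "s \<preceq> p" "s \<preceq> q" by blast
  then show "basic p \<inter> basic q \<noteq> {}"
    using basic_mono[OF s(1)] basic_mono[OF s(2)] basic_nonempty[OF leD(1)[OF s(1)]] by blast
qed

lemma basic_Int_imp_nbr: "basic p \<inter> basic q \<noteq> {} \<Longrightarrow> fst p = fst q \<Longrightarrow> nbr p q"
  unfolding basic_Int_nonempty_iff using common_lower_bound_imp_nbr by blast

lemma topspace_SP [simp]: "topspace SP = points"
  by (auto simp: spectrum_def)

lemma points_nonempty: "points \<noteq> {}"
proof -
  have "P \<inter> level n \<noteq> {}" for n
    using level_ne[of n] by (auto simp: level_iff)
  then have "selector P r P"
    using leD(2) by (intro upset_selector) blast+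
  then show ?thesis using ex_point_subset by blast
qed

lemma openin_basic: "p \<in> P \<Longrightarrow> openin SP (basic p)"
  unfolding spectrum_def basic_def by (rule topology_generated_by_Basis) blast

text \<open>The subbase is a base because points are filters: two members of a point have a common
  lower bound in it, which settles the intersection case of the induction.\<close>

lemma openin_SP_iff: "openin SP U \<longleftrightarrow> U \<subseteq> points \<and> (\<forall>S\<in>U. \<exists>p\<in>S. basic p \<subseteq> U)"
proof
  assume U: "openin SP U"
  then have "generate_topology_on (insert points (basic ` P)) U"
    unfolding spectrum_def openin_topology_generated_by_iff basic_def .
  then have "\<forall>S\<in>U. \<exists>p\<in>S. basic p \<subseteq> U"
  proof induction
    case Empty
    show ?case by simp
  next
    case (Int a b)
    have sub: "a \<subseteq> points" "b \<subseteq> points"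
      using Int.hyps openin_subset[of SP]
      by (simp_all add: spectrum_def basic_def[abs_def] openin_topology_generated_by_iff) blast+
    show ?case
    proof
      fix S assume S: "S \<in> a \<inter> b"
      then obtain p q where pq: "p \<in> S" "q \<in> S" "basic p \<subseteq> a" "basic q \<subseteq> b"
        using Int.IH by blast
      then obtain g where "g \<in> S" "g \<preceq> p" "g \<preceq> q"
        using point_common_lower_bound[of S p q] S sub by blast
      then show "\<exists>p\<in>S. basic p \<subseteq> a \<inter> b"
        using basic_mono pq by blast
    qed
  next
    case (UN K)
    show ?case
    proof
      fix S assume "S \<in> \<Union>K"
      then obtain k where "k \<in> K" "S \<in> k" by blast
      with UN.IH[of k] obtain p where "p \<in> S" "basic p \<subseteq> k" by blast
      with \<open>k \<in> K\<close> show "\<exists>p\<in>S. basic p \<subseteq> \<Union>K" by blast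
    qed
  next
    case (Basis U)
    show ?case
    proof
      fix S assume S: "S \<in> U"
      from Basis consider "U = points" | q where "U = basic q" by blast
      then show "\<exists>p\<in>S. basic p \<subseteq> U"
      proof cases
        case 1
        with S obtain g where "g \<in> S" using point_level[of S 0] by blast
        with 1 show ?thesis unfolding basic_def by blast
      next
        case 2
        with S show ?thesis unfolding basic_def by blast
      qed
    qed
  qed
  moreover have "U \<subseteq> points" using openin_subset[OF U] by simp
  ultimately show "U \<subseteq> points \<and> (\<forall>S\<in>U. \<exists>p\<in>S. basic p \<subseteq> U)" by (intro conjI)
next
  assume U: "U \<subseteq> points \<and> (\<forall>S\<in>U. \<exists>p\<in>S. basic p \<subseteq> U)"
  have "\<exists>V. openin SP V \<and> S \<in> V \<and> V \<subseteq> U" if "S \<in> U" for S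
  proof -
    have "\<exists>p\<in>S. basic p \<subseteq> U" by (rule bspec[OF conjunct2[OF U] that])
    then obtain p where p: "p \<in> S" "basic p \<subseteq> U" ..
    have "S \<in> points" by (rule subsetD[OF conjunct1[OF U] that])
    with p point_subset have "p \<in> P" "S \<in> basic p" by (auto simp: basic_def)
    with p openin_basic show ?thesis by metis
  qed
  then show "openin SP U" by (subst openin_subopen) simp
qed

text \<open>The elements whose basic set fits into a member of the cover form a cap. Otherwise their
  complement would contain a point \<open>S\<close>, yet the member of the cover around
  \<open>S\<close> contains \<open>basic p\<close> for some \<open>p\<close> in \<open>S\<close>.
  This gives compactness and all later refinements of covers.\<close>

lemma open_cover_level:
  assumes "\<And>U. U \<in> \<U> \<Longrightarrow> openin SP U" "points \<subseteq> \<Union>\<U>"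
  obtains n where "\<And>m g. m \<ge> n \<Longrightarrow> g \<in> level m \<Longrightarrow> \<exists>U\<in>\<U>. basic g \<subseteq> U"
proof -
  define C where "C = {p \<in> P. \<exists>U\<in>\<U>. basic p \<subseteq> U}"
  have "cap P r C"
  proof (rule ccontr)
    assume "\<not> cap P r C"
    moreover have "P - (P - C) = C" by (auto simp: C_def)
    ultimately obtain S where S: "S \<in> points" "S \<subseteq> P - C"
      using ex_point_subset[of "P - C"] unfolding selector_iff_not_cap by auto
    with assms(2) obtain U where "U \<in> \<U>" "S \<in> U" by blast
    with assms(1)[of U] obtain p where "p \<in> S" "basic p \<subseteq> U"
      unfolding openin_SP_iff by blast
    with S \<open>U \<in> \<U>\<close> show False by (auto simp: C_def)
  qed
  then obtain n where n: "\<forall>g\<in>level n. \<exists>c\<in>C. g \<preceq> c"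
    unfolding cap_iff by blast
  have "\<exists>U\<in>\<U>. basic g \<subseteq> U" if "m \<ge> n" "g \<in> level m" for m g
  proof -
    have "\<exists>c\<in>C. g \<preceq> c" by (rule refines_deeper[OF n that])
    then obtain c where c: "c \<in> C" "g \<preceq> c" by blast
    then show ?thesis using basic_mono[OF c(2)] unfolding C_def by blast
  qed
  with that show thesis by blast
qed

lemma points_eq_Union_level: "points = \<Union>(basic ` level n)"
proof (intro equalityI subsetI)
  fix S assume "S \<in> points"
  with point_level[of S n] show "S \<in> \<Union>(basic ` level n)" by (auto simp: basic_def)
qed (auto simp: basic_def)

lemma compact_SP: "compact_space SP"
  unfolding compact_space_alt
proof (intro allI impI, elim conjE)
  fix \<U> assume "\<forall>U\<in>\<U>. openin SP U" "topspace SP \<subseteq> \<Union>\<U>"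
  then obtain n where "\<And>g. g \<in> level n \<Longrightarrow> \<exists>U\<in>\<U>. basic g \<subseteq> U"
    using open_cover_level[of \<U>] topspace_SP order_refl by metis
  then obtain u where u: "\<And>g. g \<in> level n \<Longrightarrow> u g \<in> \<U> \<and> basic g \<subseteq> u g" by metis
  then show "\<exists>\<F>. finite \<F> \<and> \<F> \<subseteq> \<U> \<and> topspace SP \<subseteq> \<Union>\<F>"
    unfolding topspace_SP points_eq_Union_level[of n]
    by (intro exI[of _ "u ` level n"]) (use finite_level in blast)
qed

lemma second_countable_SP: "second_countable SP"
  unfolding second_countable_def
proof (intro exI conjI)
  have "countable P"
    unfolding induced_carrier_def using graph_G by (auto simp: graph_def intro: countable_finite)
  then show "countable (basic ` P)" by simp
  show "\<forall>V\<in>basic ` P. openin SP V" using openin_basic by blast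
  show "\<forall>U x. openin SP U \<and> x \<in> U \<longrightarrow> (\<exists>V\<in>basic ` P. x \<in> V \<and> V \<subseteq> U)"
  proof (intro allI impI)
    fix U S assume "openin SP U \<and> S \<in> U"
    then obtain p where "p \<in> S" "basic p \<subseteq> U" "S \<in> points"
      unfolding openin_SP_iff by blast
    then show "\<exists>V\<in>basic ` P. S \<in> V \<and> V \<subseteq> U"
      using point_subset by (intro bexI[of _ "basic p"]) (auto simp: basic_def)
  qed
qed

section \<open>The properties of morphisms and sequences, restated in the poset\<close>

lemma edge_faithful_iff: "edge_faithful G R \<longleftrightarrow> (\<forall>p q. nbr p q \<longrightarrow> (\<exists>s. s \<preceq> p \<and> s \<preceq> q))"
proof
  assume EF: "edge_faithful G R"
  show "\<forall>p q. nbr p q \<longrightarrow> (\<exists>s. s \<preceq> p \<and> s \<preceq> q)"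
  proof (intro allI impI)
    fix p q assume pq: "nbr p q"
    obtain n x y where [simp]: "p = (n, x)" "q = (n, y)"
      using nbrD(3)[OF pq] by (metis prod.collapse)
    have "x \<in> verts (G n)" "y \<in> verts (G n)"
      using nbrD(1,2)[OF pq] by (simp_all add: induced_carrier_def)
    moreover have "(x, y) \<in> adj (G n)" using pq by (simp add: nbr_def)
    ultimately have "\<exists>s\<in>P. s \<preceq> (n, x) \<and> s \<preceq> (n, y)"
      using EF unfolding edge_faithful_def by metis
    then show "\<exists>s. s \<preceq> p \<and> s \<preceq> q" by auto
  qed
next
  assume *: "\<forall>p q. nbr p q \<longrightarrow> (\<exists>s. s \<preceq> p \<and> s \<preceq> q)"
  show "edge_faithful G R"
    unfolding edge_faithful_def
  proof (intro allI ballI)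
    fix n x y assume "x \<in> verts (G n)" "y \<in> verts (G n)"
    have "(x, y) \<in> adj (G n) \<longleftrightarrow> nbr (n, x) (n, y)" by (simp add: nbr_def)
    also have "\<dots> \<longleftrightarrow> (\<exists>s\<in>P. s \<preceq> (n, x) \<and> s \<preceq> (n, y))"
      using * common_lower_bound_imp_nbr leD(1) by (metis fst_conv)
    finally show "(x, y) \<in> adj (G n) \<longleftrightarrow> (\<exists>s\<in>P. s \<preceq> (n, x) \<and> s \<preceq> (n, y))" .
  qed
qed

lemma edge_witnessing_iff:
  assumes "m \<le> n"
  shows "edge_witnessing (G n) (G m) (R m n) \<longleftrightarrow>
    (\<forall>p q. nbr p q \<and> fst p = m \<longrightarrow> (\<exists>s\<in>level n. s \<preceq> p \<and> s \<preceq> q))"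
proof -
  have "(\<exists>s\<in>level n. s \<preceq> (m, x) \<and> s \<preceq> (m, y)) \<longleftrightarrow> (\<exists>z\<in>verts (G n). (x, z) \<in> R m n \<and> (y, z) \<in> R m n)"
    for x y using assms by (simp add: level_def le_iff)
  then show ?thesis
    unfolding edge_witnessing_def nbr_def by (simp add: split_paired_all)
qed

lemma star_refining_iff:
  assumes "m \<le> n"
  shows "star_refining (G n) (G m) (R m n) \<longleftrightarrow>
    (\<forall>g\<in>level n. \<exists>h\<in>level m. \<forall>g'. nbr g' g \<longrightarrow> g' \<preceq> h)"
proof -
  have "{g' \<in> verts (G n). (g', x) \<in> adj (G n)} \<subseteq> R m n `` {y} \<longleftrightarrow>
    (\<forall>g'. nbr g' (n, x) \<longrightarrow> g' \<preceq> (m, y))" for x y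
  proof
    assume sub: "{g' \<in> verts (G n). (g', x) \<in> adj (G n)} \<subseteq> R m n `` {y}"
    show "\<forall>g'. nbr g' (n, x) \<longrightarrow> g' \<preceq> (m, y)"
    proof (intro allI impI)
      fix g' assume g': "nbr g' (n, x)"
      then obtain z where [simp]: "g' = (n, z)" using nbrD(3)[OF g'] by (cases g') simp
      have "z \<in> verts (G n)" using nbrD(1)[OF g'] by (simp add: induced_carrier_def)
      with g' sub have "(y, z) \<in> R m n" by (auto simp: nbr_def)
      with assms show "g' \<preceq> (m, y)" by (simp add: le_iff)
    qed
  next
    assume *: "\<forall>g'. nbr g' (n, x) \<longrightarrow> g' \<preceq> (m, y)"
    show "{g' \<in> verts (G n). (g', x) \<in> adj (G n)} \<subseteq> R m n `` {y}"
    proof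
      fix z assume "z \<in> {g' \<in> verts (G n). (g', x) \<in> adj (G n)}"
      then have "nbr (n, z) (n, x)" by (simp add: nbr_def)
      with * show "z \<in> R m n `` {y}" by (simp add: le_iff)
    qed
  qed
  then show ?thesis
    unfolding star_refining_def level_def by simp
qed

lemma nbr_imp_ex_point:
  assumes "edge_faithful G R" "nbr p q"
  obtains S where "S \<in> basic p" "S \<in> basic q"
  using assms basic_Int_nonempty_iff unfolding edge_faithful_iff by (metis Int_iff ex_in_conv)

end

subsection \<open>Sequences of trees\<close>

locale tree_seq = B_seq +
  assumes tree_G: "tree (G n)"
begin

section \<open>Splitting and lifting edges of trees\<close>

text \<open>Stated for any connected \<open>C\<close>: besides whole levels, it is applied to
  preimages of single vertices under monotone relations.\<close>

lemma gconnected_level_split: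
  assumes "gconnected (G n) C" "A \<union> B = Pair n ` C" "A \<inter> B = {}" "A \<noteq> {}" "B \<noteq> {}"
  obtains a b where "a \<in> A" "b \<in> B" "nbr a b"
proof -
  have inj: "inj_on snd (Pair n ` C)" by (auto simp: inj_on_def)
  have "snd ` A \<union> snd ` B = C"
    unfolding image_Un[symmetric] assms(2) by (simp add: image_image)
  moreover have "snd ` A \<inter> snd ` B = {}"
    using inj_on_image_Int[OF inj, of A B] assms(2,3) by auto
  ultimately obtain x y where "x \<in> snd ` A" "y \<in> snd ` B" "(x, y) \<in> adj (G n)"
    using gconnected_split[OF assms(1)] assms(4,5) by (metis image_is_empty)
  then obtain a b where ab: "a \<in> A" "b \<in> B" "(snd a, snd b) \<in> adj (G n)" by blast
  then have "a \<in> Pair n ` C" "b \<in> Pair n ` C" using assms(2) by blast+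
  then have "fst a = n" "fst b = n" by auto
  with ab that show thesis by (simp add: nbr_def)
qed

lemma level_split:
  assumes "A \<union> B = level n" "A \<inter> B = {}" "A \<noteq> {}" "B \<noteq> {}"
  obtains a b where "a \<in> A" "b \<in> B" "nbr a b"
  using gconnected_level_split[of n "verts (G n)" A B] assms tree_G[of n]
  unfolding level_def tree_def by blast

lemma nbr_split:
  assumes "nbr g h" "g \<noteq> h"
  obtains A B where "A \<union> B = level (fst g)" "A \<inter> B = {}" "g \<in> A" "h \<in> B"
    "\<And>a b. a \<in> A \<Longrightarrow> b \<in> B \<Longrightarrow> nbr a b \<Longrightarrow> a = g \<and> b = h"
proof -
  obtain n x y where [simp]: "g = (n, x)" "h = (n, y)"
    using nbrD(3)[OF assms(1)] by (metis prod.collapse)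
  obtain A B where AB: "A \<union> B = verts (G n)" "A \<inter> B = {}" "x \<in> A" "y \<in> B"
    "\<And>a b. a \<in> A \<Longrightarrow> b \<in> B \<Longrightarrow> (a, b) \<in> adj (G n) \<Longrightarrow> a = x \<and> b = y"
    using tree_edge_split[OF tree_G[of n], of x y] assms by (auto simp: nbr_def)
  show thesis
  proof (rule that[of "Pair n ` A" "Pair n ` B"])
    show "Pair n ` A \<union> Pair n ` B = level (fst g)"
      by (simp add: level_def image_Un[symmetric] AB)
    show "Pair n ` A \<inter> Pair n ` B = {}" using AB(2) by auto
    show "g \<in> Pair n ` A" "h \<in> Pair n ` B" using AB(3,4) by simp_all
    fix a b assume "a \<in> Pair n ` A" "b \<in> Pair n ` B" "nbr a b"
    then obtain u v where uv: "a = (n, u)" "b = (n, v)" "u \<in> A" "v \<in> B" "(u, v) \<in> adj (G n)"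
      by (auto simp: nbr_def)
    with AB(5)[OF uv(3-5)] show "a = g \<and> b = h" by simp
  qed
qed

text \<open>Co-bijective edge-preserving relations need not lift edges in general; between trees they do.\<close>

lemma nbr_lift:
  assumes "nbr g h" "fst g \<le> m"
  obtains g' h' where "nbr g' h'" "g' \<in> level m" "g' \<preceq> g" "h' \<preceq> h"
proof (cases "g = h")
  case True
  obtain q where "q \<in> level m" "q \<preceq> g"
    using ex_exactly_below[OF nbrD(1)[OF assms(1)] assms(2)] by metis
  with True that nbr_refl[of q] show thesis by (simp add: level_iff)
next
  case False
  obtain A B where AB: "A \<union> B = level (fst g)" "A \<inter> B = {}" "g \<in> A" "h \<in> B"
    "\<And>a b. a \<in> A \<Longrightarrow> b \<in> B \<Longrightarrow> nbr a b \<Longrightarrow> a = g \<and> b = h"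
    using nbr_split[OF assms(1) False] by metis
  have same: "fst a = fst b" if "a \<in> A" "b \<in> B" for a b
  proof -
    have "a \<in> level (fst g)" "b \<in> level (fst g)" using that AB(1) by blast+
    then show ?thesis by (simp add: level_iff)
  qed
  \<comment> \<open>The two sides are pulled back to level \<open>m\<close>, which they cover. If
    they are disjoint, connectedness gives an edge between them; if they share a vertex, its loop
    serves. In both cases the images in \<open>A\<close> and \<open>B\<close> are adjacent, hence
    equal to \<open>g\<close> and \<open>h\<close>.\<close>
  define A' where "A' = {p \<in> level m. \<exists>a\<in>A. p \<preceq> a}"
  define B' where "B' = {p \<in> level m. \<exists>b\<in>B. p \<preceq> b}"
  have "p \<in> A' \<union> B'" if p: "p \<in> level m" for p
  proof -
    have "p \<in> P" "fst g \<le> fst p" using p assms(2) by (simp_all add: level_iff)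
    then obtain q where q: "q \<in> level (fst g)" "p \<preceq> q" using ex_above by metis
    then have "q \<in> A \<or> q \<in> B" using AB(1) by blast
    with q p show ?thesis unfolding A'_def B'_def by blast
  qed
  then have un: "A' \<union> B' = level m"
    unfolding A'_def B'_def by blast
  have ne: "A' \<noteq> {}" "B' \<noteq> {}"
  proof -
    obtain q where "q \<in> level m" "q \<preceq> g"
      using ex_exactly_below[OF nbrD(1)[OF assms(1)] assms(2)] by metis
    with AB(3) show "A' \<noteq> {}" unfolding A'_def by blast
    have "fst h \<le> m" using assms nbrD(3) by simp
    then obtain q where "q \<in> level m" "q \<preceq> h"
      using ex_exactly_below[OF nbrD(2)[OF assms(1)]] by metis
    with AB(4) show "B' \<noteq> {}" unfolding B'_def by blast
  qed
  show thesis
  proof (cases "A' \<inter> B' = {}")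
    case True
    obtain p q where pq: "p \<in> A'" "q \<in> B'" "nbr p q"
      by (rule level_split[OF un True ne])
    then obtain a b where ab: "a \<in> A" "b \<in> B" "p \<preceq> a" "q \<preceq> b"
      unfolding A'_def B'_def by blast
    have "nbr a b" by (rule nbr_above[OF pq(3) ab(3,4) same[OF ab(1,2)]])
    with AB(5) ab have "a = g" "b = h" by blast+
    moreover have "p \<in> level m" using pq(1) by (simp add: A'_def)
    ultimately show thesis using that pq(3) ab by metis
  next
    case False
    then obtain p a b where p: "p \<in> level m" "a \<in> A" "b \<in> B" "p \<preceq> a" "p \<preceq> b"
      unfolding A'_def B'_def by blast
    have "nbr a b" by (rule common_lower_bound_imp_nbr[OF p(4,5) same[OF p(2,3)]])
    with AB(5) p have "a = g" "b = h" by blast+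
    with that[of p p] p nbr_refl[of p] show thesis by (simp add: level_iff)
  qed
qed

section \<open>Edge-faithfulness and connectedness\<close>

text \<open>The hypothesis provides witnesses only for edges at levels of the subsequence, so the
  given edge is first lifted to such a level.\<close>

lemma edge_witnessing_imp_edge_faithful:
  assumes "has_subseq_with edge_witnessing G R"
  shows "edge_faithful G R"
  unfolding edge_faithful_iff
proof (intro allI impI)
  fix p q assume pq: "nbr p q"
  obtain m m' where m: "fst p \<le> m" "m < m'" "edge_witnessing (G m') (G m) (R m m')"
    using has_subseq_withE[OF assms] by metis
  obtain p' q' where p': "nbr p' q'" "p' \<in> level m" "p' \<preceq> p" "q' \<preceq> q"
    using nbr_lift[OF pq m(1)] by metis
  moreover have "fst p' = m" using p'(2) by (simp add: level_iff)
  ultimately obtain s where "s \<preceq> p'" "s \<preceq> q'"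
    using m(2,3) edge_witnessing_iff[of m m'] by (metis less_imp_le)
  with p' le_trans show "\<exists>s. s \<preceq> p \<and> s \<preceq> q" by blast
qed

text \<open>By connectedness the open sets belonging to the two sides of the edge meet, say in
  \<open>basic a\<close> and \<open>basic b\<close>. Then \<open>a\<close> and \<open>b\<close> are
  adjacent, so they are the ends of the edge.\<close>

lemma connected_imp_edge_faithful:
  assumes "connected_space SP"
  shows "edge_faithful G R"
  unfolding edge_faithful_iff
proof (intro allI impI)
  fix g h assume gh: "nbr g h"
  show "\<exists>s. s \<preceq> g \<and> s \<preceq> h"
  proof (cases "g = h")
    case True
    with gh nbrD le_refl show ?thesis by blast
  next
    case False
    obtain A B where AB: "A \<union> B = level (fst g)" "A \<inter> B = {}" "g \<in> A" "h \<in> B"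
      "\<And>a b. a \<in> A \<Longrightarrow> b \<in> B \<Longrightarrow> nbr a b \<Longrightarrow> a = g \<and> b = h"
      using nbr_split[OF gh False] by metis
    have lev: "a \<in> P" "fst a = fst g" if "a \<in> A \<union> B" for a
      using that unfolding AB(1) by (simp_all add: level_iff)
    have "openin SP (\<Union>(basic ` A))" "openin SP (\<Union>(basic ` B))"
      using lev openin_basic by (auto intro!: openin_Union)
    moreover have "topspace SP \<subseteq> \<Union>(basic ` A) \<union> \<Union>(basic ` B)"
      using points_eq_Union_level[of "fst g"] by (simp add: AB(1)[symmetric] image_Un)
    moreover have "\<Union>(basic ` A) \<noteq> {}" "\<Union>(basic ` B) \<noteq> {}"
      using basic_nonempty[of g] basic_nonempty[of h] AB(3,4) lev by blast+
    ultimately have "\<Union>(basic ` A) \<inter> \<Union>(basic ` B) \<noteq> {}"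
      using assms unfolding connected_space_def by metis
    then obtain S a b where S: "a \<in> A" "b \<in> B" "S \<in> basic a" "S \<in> basic b" by blast
    then have "basic a \<inter> basic b \<noteq> {}" by blast
    then have "nbr a b"
      using lev[of a] lev[of b] S by (intro basic_Int_imp_nbr) auto
    with AB(5) S have "a = g" "b = h" by blast+
    with S basic_Int_nonempty_iff show ?thesis by blast
  qed
qed

text \<open>A separation of the spectrum divides some level into two parts. Connectedness of that
  level gives an edge between them, and the ends of the edge share a point.\<close>

lemma edge_faithful_imp_connected:
  assumes EF: "edge_faithful G R"
  shows "connected_space SP"
  unfolding connected_space_def
proof (intro notI, elim exE conjE)
  fix U V
  assume UV: "openin SP U" "openin SP V" "topspace SP \<subseteq> U \<union> V" "U \<inter> V = {}" "U \<noteq> {}" "V \<noteq> {}"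
  obtain n where n: "\<And>g. g \<in> level n \<Longrightarrow> basic g \<subseteq> U \<or> basic g \<subseteq> V"
  proof -
    have "\<And>W. W \<in> {U, V} \<Longrightarrow> openin SP W" "points \<subseteq> \<Union>{U, V}" using UV(1-3) by auto
    then show thesis
    proof (rule open_cover_level)
      fix n assume "\<And>m g. m \<ge> n \<Longrightarrow> g \<in> level m \<Longrightarrow> \<exists>W\<in>{U, V}. basic g \<subseteq> W"
      then have "\<exists>W\<in>{U, V}. basic g \<subseteq> W" if "g \<in> level n" for g using that by blast
      then show thesis by (intro that) blast
    qed
  qed
  define A where "A = {g \<in> level n. basic g \<subseteq> U}"
  define B where "B = {g \<in> level n. basic g \<subseteq> V}"
  have ne: "\<exists>g\<in>level n. S \<in> basic g" if "S \<in> points" for S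
    using that points_eq_Union_level[of n] by auto
  have sub: "U \<subseteq> points" "V \<subseteq> points" using UV(1,2) openin_subset by force+
  have "A \<union> B = level n" using n by (auto simp: A_def B_def)
  moreover have "A \<inter> B = {}"
  proof (rule equals0I)
    fix g assume "g \<in> A \<inter> B"
    then have "basic g \<subseteq> U \<inter> V" "g \<in> P" by (auto simp: A_def B_def level_iff)
    with basic_nonempty[of g] UV(4) show False by simp
  qed
  moreover have "A \<noteq> {}"
  proof -
    obtain S where "S \<in> U" using UV(5) by blast
    with ne[of S] sub obtain g where "g \<in> level n" "S \<in> basic g" by blast
    with n[of g] \<open>S \<in> U\<close> UV(4) have "g \<in> A" by (auto simp: A_def)
    then show ?thesis by blast
  qed
  moreover have "B \<noteq> {}"
  proof -
    obtain S where "S \<in> V" using UV(6) by blast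
    with ne[of S] sub obtain g where "g \<in> level n" "S \<in> basic g" by blast
    with n[of g] \<open>S \<in> V\<close> UV(4) have "g \<in> B" by (auto simp: B_def)
    then show ?thesis by blast
  qed
  ultimately obtain a b where ab: "a \<in> A" "b \<in> B" "nbr a b" by (rule level_split)
  obtain S where "S \<in> basic a" "S \<in> basic b" using nbr_imp_ex_point[OF EF ab(3)] .
  with ab UV(4) show False by (auto simp: A_def B_def)
qed

section \<open>Star refinement and the Hausdorff property\<close>

text \<open>Choose \<open>s\<close> in \<open>S\<close> but not in \<open>T\<close>. If vertices of
  \<open>S\<close> and \<open>T\<close> at a deep level had overlapping basic sets, they would lie
  in one star and so below a common \<open>h\<close>, which then belongs to both points. At that
  depth membership of \<open>h\<close> in \<open>S\<close> puts it below \<open>s\<close>, forcing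
  \<open>s\<close> into \<open>T\<close>.\<close>

lemma star_refining_imp_Hausdorff:
  assumes "has_subseq_with star_refining G R"
  shows "Hausdorff_space SP"
  unfolding Hausdorff_space_def
proof (intro allI impI, elim conjE)
  fix S T assume ST: "S \<in> topspace SP" "T \<in> topspace SP" "S \<noteq> T"
  then have S: "S \<in> points" and T: "T \<in> points" by simp_all
  have "\<not> S \<subseteq> T" using point_minimal[OF T point_selector[OF S]] ST(3) by blast
  then obtain s where s: "s \<in> S" "s \<notin> T" by blast
  obtain n where n: "\<And>m g. m \<ge> n \<Longrightarrow> g \<in> S \<Longrightarrow> g \<in> level m \<Longrightarrow> g \<preceq> s"
    using point_eventually_below[OF S s(1)] by metis
  obtain m m' where m: "n \<le> m" "m < m'" "star_refining (G m') (G m) (R m m')"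
    using has_subseq_withE[OF assms] by metis
  obtain g where g: "g \<in> level m'" "g \<in> S" using point_level[OF S] by metis
  obtain g' where g': "g' \<in> level m'" "g' \<in> T" using point_level[OF T] by metis
  have "basic g \<inter> basic g' = {}"
  proof (rule ccontr)
    assume "basic g \<inter> basic g' \<noteq> {}"
    then have "nbr g' g"
      using g g' by (intro nbr_sym[OF basic_Int_imp_nbr]) (simp_all add: level_iff)
    moreover obtain h where h: "h \<in> level m" "\<And>k. nbr k g \<Longrightarrow> k \<preceq> h"
      using m(2,3) g(1) star_refining_iff[of m m'] by (metis less_imp_le)
    moreover have "nbr g g" using g by (simp add: nbr_refl level_iff)
    ultimately have "g' \<preceq> h" "g \<preceq> h" by blast+
    then have "h \<in> T" "h \<in> S" using point_upset S T g g' by metis+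
    with n[OF m(1) _ h(1)] have "h \<preceq> s" by blast
    with \<open>h \<in> T\<close> point_upset[OF T] s(2) show False by blast
  qed
  moreover have "openin SP (basic g)" "openin SP (basic g')"
    using g g' by (simp_all add: openin_basic level_iff)
  moreover have "S \<in> basic g" "T \<in> basic g'" using S T g g' by (simp_all add: basic_def)
  ultimately show "\<exists>U V. openin SP U \<and> openin SP V \<and> S \<in> U \<and> T \<in> V \<and> disjnt U V"
    unfolding disjnt_def by metis
qed

text \<open>A level has finitely many edges, so some depth bounds one common lower bound for each of
  them. From there on, \<open>ex_exactly_below\<close> pushes these bounds down to any
  level.\<close>

lemma edge_faithful_imp_edge_witnessing:
  assumes "edge_faithful G R"
  shows "has_subseq_with edge_witnessing G R"
proof (rule has_subseq_withI)
  fix m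
  define E where "E = {(p, q). nbr p q \<and> fst p = m}"
  have "E \<subseteq> level m \<times> level m"
    using nbrD by (auto simp: E_def level_iff) fastforce+
  then have fin: "finite E" using finite_level finite_subset by blast
  obtain s where s: "\<And>p q. nbr p q \<Longrightarrow> s p q \<preceq> p \<and> s p q \<preceq> q"
    using assms unfolding edge_faithful_iff by metis
  \<comment> \<open>Inserting \<open>0\<close> makes the argument of \<open>Max\<close> visibly
    non-empty.\<close>
  define N where "N = Max (insert 0 ((\<lambda>(p, q). fst (s p q)) ` E))"
  have "edge_witnessing (G n) (G m) (R m n)" if n: "n \<ge> N" "m \<le> n" for n
    unfolding edge_witnessing_iff[OF n(2)]
  proof (intro allI impI, elim conjE)
    fix p q assume pq: "nbr p q" "fst p = m"
    then have "(p, q) \<in> E" by (simp add: E_def)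
    then have "fst (s p q) \<in> (\<lambda>(p, q). fst (s p q)) ` E" by force
    then have "fst (s p q) \<le> N" unfolding N_def using fin by (intro Max_ge) auto
    moreover have "s p q \<in> P" using s[OF pq(1)] leD(1) by blast
    ultimately obtain t where "t \<in> level n" "t \<preceq> s p q"
      using ex_exactly_below[of "s p q" n] n(1) by (metis order_trans)
    with s[OF pq(1)] le_trans show "\<exists>t\<in>level n. t \<preceq> p \<and> t \<preceq> q" by metis
  qed
  then show "\<exists>N. \<forall>n\<ge>N. m \<le> n \<longrightarrow> edge_witnessing (G n) (G m) (R m n)" by blast
qed

text \<open>For sets described only from level \<open>n\<close> on: closing \<open>W\<close> upwards
  gives a selector, and any element this adds lies at a level before \<open>n\<close>.\<close>

lemma ex_point_subset_above:
  assumes W: "\<And>m. m \<ge> n \<Longrightarrow> W \<inter> level m \<noteq> {}" "W \<subseteq> P"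
    and up: "\<And>p q. p \<in> W \<Longrightarrow> p \<preceq> q \<Longrightarrow> fst q \<ge> n \<Longrightarrow> q \<in> W"
  obtains S where "S \<in> points" "\<And>p. p \<in> S \<Longrightarrow> fst p \<ge> n \<Longrightarrow> p \<in> W"
proof -
  define W' where "W' = {q. \<exists>p\<in>W. p \<preceq> q}"
  have "selector P r W'"
  proof (rule upset_selector)
    show "W' \<subseteq> P" unfolding W'_def using leD(2) by blast
    show "q \<in> W'" if "p \<in> W'" "p \<preceq> q" for p q
      using that le_trans unfolding W'_def by blast
    fix m
    obtain p where p: "p \<in> W" "p \<in> level (max m n)" using W(1)[of "max m n"] by auto
    then have "p \<in> P" "m \<le> fst p" by (simp_all add: level_iff)
    then obtain q where "q \<in> level m" "p \<preceq> q" using ex_above by metis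
    with p show "W' \<inter> level m \<noteq> {}" unfolding W'_def by blast
  qed
  then obtain S where S: "S \<in> points" "S \<subseteq> W'" using ex_point_subset by metis
  have "p \<in> W" if "p \<in> S" "fst p \<ge> n" for p
  proof -
    have "p \<in> W'" using that(1) S(2) by blast
    then obtain q where "q \<in> W" "q \<preceq> p" unfolding W'_def by blast
    then show ?thesis using up that(2) by blast
  qed
  with S(1) that show thesis by blast
qed

text \<open>
  If star refinement fails at all levels, the vertices whose stars fail form an up-closed set, which
  contains a minimal selector \<open>S\<close>. For \<open>h \<in> S\<close>, the neighbours of \<open>S\<close> that are not below \<open>h\<close> again form
  an up-closed set and contain a minimal selector \<open>T \<noteq> S\<close>; by edge-faithfulness it cannot be
  separated from \<open>S\<close>.
\<close>

lemma Hausdorff_imp_star_refining_at: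
  assumes EF: "edge_faithful G R" and H: "Hausdorff_space SP"
  shows "\<exists>m\<ge>n. \<forall>g\<in>level m. \<exists>h\<in>level n. \<forall>g'. nbr g' g \<longrightarrow> g' \<preceq> h"
proof (rule ccontr)
  assume contra: "\<not> ?thesis"
  define bad where "bad = {g \<in> P. fst g \<ge> n \<and> (\<forall>h\<in>level n. \<exists>g'. nbr g' g \<and> \<not> g' \<preceq> h)}"
  have "bad \<inter> level m \<noteq> {}" if mn: "m \<ge> n" for m
  proof -
    obtain g where "g \<in> level m" "\<forall>h\<in>level n. \<exists>g'. nbr g' g \<and> \<not> g' \<preceq> h"
      using contra mn by metis
    with mn have "g \<in> bad" by (simp add: bad_def level_iff)
    with \<open>g \<in> level m\<close> show ?thesis by blast
  qed
  moreover have "bad \<subseteq> P" by (auto simp: bad_def)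
  moreover have "q \<in> bad" if pq: "p \<in> bad" "p \<preceq> q" "fst q \<ge> n" for p q
  proof -
    have "\<exists>q'. nbr q' q \<and> \<not> q' \<preceq> h" if h: "h \<in> level n" for h
    proof -
      obtain p' where p': "nbr p' p" "\<not> p' \<preceq> h" using pq(1) h unfolding bad_def by blast
      have "fst q \<le> fst p'" using nbrD(3)[OF p'(1)] leD(3)[OF pq(2)] by simp
      then obtain q' where q': "q' \<in> level (fst q)" "p' \<preceq> q'"
        using ex_above nbrD(1)[OF p'(1)] by metis
      have "nbr q' q"
        by (rule nbr_above[OF p'(1) q'(2) pq(2)]) (use q' in \<open>simp add: level_iff\<close>)
      with q' p' le_trans show ?thesis by blast
    qed
    with pq leD(2) show ?thesis unfolding bad_def by blast
  qed
  ultimately obtain S where S: "S \<in> points" "\<And>p. p \<in> S \<Longrightarrow> fst p \<ge> n \<Longrightarrow> p \<in> bad"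
    using ex_point_subset_above by metis
  obtain h where h: "h \<in> level n" "h \<in> S" using point_level[OF S(1)] by metis
  define W where "W = {g' \<in> P. fst g' \<ge> n \<and> \<not> g' \<preceq> h \<and> (\<exists>g\<in>S. nbr g' g)}"
  have "W \<inter> level m \<noteq> {}" if "m \<ge> n" for m
  proof -
    obtain g where g: "g \<in> level m" "g \<in> S" using point_level[OF S(1)] by metis
    with that S(2) have "g \<in> bad" by (simp add: level_iff)
    then obtain g' where g': "nbr g' g" "\<not> g' \<preceq> h" using h(1) unfolding bad_def by blast
    have "g' \<in> P" "fst g' = m" using nbrD(1,3)[OF g'(1)] g(1) by (simp_all add: level_iff)
    with g g' that have "g' \<in> W" unfolding W_def by blast
    moreover have "g' \<in> level m" using \<open>g' \<in> P\<close> \<open>fst g' = m\<close> by (simp add: level_iff)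
    ultimately have "g' \<in> W \<inter> level m" by simp
    then show ?thesis by blast
  qed
  moreover have "W \<subseteq> P" by (auto simp: W_def)
  moreover have "q \<in> W" if pq: "p \<in> W" "p \<preceq> q" "fst q \<ge> n" for p q
  proof -
    obtain g where g: "g \<in> S" "nbr p g" using pq(1) by (auto simp: W_def)
    have "fst q \<le> fst g" using nbrD(3)[OF g(2)] leD(3)[OF pq(2)] by simp
    then obtain k where k: "k \<in> level (fst q)" "g \<preceq> k" using ex_above nbrD(2)[OF g(2)] by metis
    have "nbr q k"
      by (rule nbr_above[OF g(2) pq(2) k(2)]) (use k in \<open>simp add: level_iff\<close>)
    moreover have "k \<in> S" by (rule point_upset[OF S(1) g(1) k(2)])
    moreover have "\<not> q \<preceq> h" using pq(1) le_trans[OF pq(2)] unfolding W_def by blast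
    ultimately show ?thesis using pq(3) leD(2)[OF pq(2)] unfolding W_def by blast
  qed
  ultimately obtain T where T: "T \<in> points" "\<And>p. p \<in> T \<Longrightarrow> fst p \<ge> n \<Longrightarrow> p \<in> W"
    using ex_point_subset_above by metis
  have "h \<notin> W" using h le_refl[of h] unfolding W_def level_iff by blast
  then have "h \<notin> T" using T(2)[of h] h(1) unfolding level_iff by blast
  with h(2) have "S \<noteq> T" by blast
  then obtain U V where UV: "openin SP U" "openin SP V" "S \<in> U" "T \<in> V" "disjnt U V"
    using H S(1) T(1) unfolding Hausdorff_space_def topspace_SP by metis
  obtain s where s: "s \<in> S" "basic s \<subseteq> U" using UV(1,3) unfolding openin_SP_iff by metis
  obtain t where t: "t \<in> T" "basic t \<subseteq> V" using UV(2,4) unfolding openin_SP_iff by metis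
  obtain k where k: "\<And>m g. m \<ge> k \<Longrightarrow> g \<in> S \<Longrightarrow> g \<in> level m \<Longrightarrow> g \<preceq> s"
    using point_eventually_below[OF S(1) s(1)] by metis
  obtain l where l: "\<And>m g. m \<ge> l \<Longrightarrow> g \<in> T \<Longrightarrow> g \<in> level m \<Longrightarrow> g \<preceq> t"
    using point_eventually_below[OF T(1) t(1)] by metis
  \<comment> \<open>At this level the vertices of \<open>S\<close> lie below \<open>s\<close>, those
    of \<open>T\<close> lie below \<open>t\<close>, and the latter belong to \<open>W\<close>. So an
    edge joins a vertex below \<open>t\<close> to one below \<open>s\<close>, and its ends share a
    point of \<open>U\<close> and \<open>V\<close>.\<close>
  define m where "m = max n (max k l)"
  have m: "m \<ge> n" "m \<ge> k" "m \<ge> l" by (simp_all add: m_def)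
  obtain t' where t': "t' \<in> level m" "t' \<in> T" using point_level[OF T(1)] by metis
  then have "t' \<in> W" using T(2) m(1) by (simp add: level_iff)
  then obtain g where g: "g \<in> S" "nbr t' g" unfolding W_def by blast
  have "g \<in> level m" using nbrD(2,3)[OF g(2)] t'(1) by (simp add: level_iff)
  then have "g \<preceq> s" using k m(2) g(1) by blast
  moreover have "t' \<preceq> t" using l m(3) t' by blast
  moreover obtain Z where "Z \<in> basic t'" "Z \<in> basic g" using nbr_imp_ex_point[OF EF g(2)] .
  ultimately have "Z \<in> basic s" "Z \<in> basic t" using basic_mono by (metis subsetD)+
  with s(2) t(2) have "Z \<in> U" "Z \<in> V" by (metis subsetD)+
  with UV(5) show False by (auto simp: disjnt_def)
qed

text \<open>Star refinement between levels \<open>m\<close> and \<open>N\<close> passes to every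
  deeper \<open>n\<close>: for \<open>k\<close> above \<open>g\<close> at level \<open>N\<close>,
  each neighbour of \<open>g\<close> lies below a neighbour of \<open>k\<close>.\<close>

lemma Hausdorff_imp_star_refining:
  assumes EF: "edge_faithful G R" and H: "Hausdorff_space SP"
  shows "has_subseq_with star_refining G R"
proof (rule has_subseq_withI)
  fix m
  obtain N where N: "N \<ge> m" "\<And>g. g \<in> level N \<Longrightarrow> \<exists>h\<in>level m. \<forall>g'. nbr g' g \<longrightarrow> g' \<preceq> h"
    using Hausdorff_imp_star_refining_at[OF assms, of m] by metis
  have "star_refining (G n) (G m) (R m n)" if n: "n \<ge> N" "m \<le> n" for n
    unfolding star_refining_iff[OF n(2)]
  proof
    fix g assume "g \<in> level n"
    then have g: "g \<in> P" "fst g = n" by (simp_all add: level_iff)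
    then obtain k where k: "k \<in> level N" "g \<preceq> k" using ex_above n(1) by metis
    obtain h where h: "h \<in> level m" "\<And>k'. nbr k' k \<Longrightarrow> k' \<preceq> h" using N(2)[OF k(1)] by metis
    have "g' \<preceq> h" if g': "nbr g' g" for g'
    proof -
      have "N \<le> fst g'" using nbrD(3)[OF g'] g(2) \<open>n \<ge> N\<close> by simp
      then obtain k' where k': "k' \<in> level N" "g' \<preceq> k'" using ex_above nbrD(1)[OF g'] by metis
      have "nbr k' k"
        by (rule nbr_above[OF g' k'(2) k(2)]) (use k k' in \<open>simp add: level_iff\<close>)
      with h(2) k'(2) le_trans show ?thesis by blast
    qed
    with h(1) show "\<exists>h\<in>level m. \<forall>g'. nbr g' g \<longrightarrow> g' \<preceq> h" by blast
  qed
  then show "\<exists>N. \<forall>n\<ge>N. m \<le> n \<longrightarrow> star_refining (G n) (G m) (R m n)" by blast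
qed

section \<open>Tree-likeness\<close>

text \<open>Distinct vertices have distinct basic sets, and by edge-faithfulness these overlap
  exactly along edges, so the overlap graph is a copy of \<open>G n\<close>.\<close>

lemma tree_overlap_graph_level:
  assumes EF: "edge_faithful G R"
  shows "tree (overlap_graph (basic ` level n))"
proof (rule tree_bij_betw[OF tree_G[of n]])
  let ?f = "\<lambda>x. basic (n, x)"
  show "bij_betw ?f (verts (G n)) (verts (overlap_graph (basic ` level n)))"
    using basic_inj_on_level[of n]
    by (auto simp: bij_betw_def overlap_graph_def level_def inj_on_def image_image)
  show "(?f x, ?f y) \<in> adj (overlap_graph (basic ` level n)) \<longleftrightarrow> (x, y) \<in> adj (G n)"
    if "x \<in> verts (G n)" "y \<in> verts (G n)" for x y
  proof -
    have "(?f x, ?f y) \<in> adj (overlap_graph (basic ` level n)) \<longleftrightarrow> ?f x \<inter> ?f y \<noteq> {}"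
      using that by (auto simp: overlap_graph_def level_def)
    also have "\<dots> \<longleftrightarrow> nbr (n, x) (n, y)"
      using basic_Int_imp_nbr nbr_imp_ex_point[OF EF] by (metis Int_iff empty_iff fst_conv)
    finally show ?thesis by (simp add: nbr_def)
  qed
qed (auto simp: overlap_graph_def)

lemma tree_like_SP:
  assumes "edge_faithful G R"
  shows "tree_like SP"
  unfolding tree_like_def
proof (intro allI impI)
  fix \<U> assume "open_cover SP \<U>"
  then have \<U>: "\<And>U. U \<in> \<U> \<Longrightarrow> openin SP U" "points \<subseteq> \<Union>\<U>" by (auto simp: open_cover_def)
  obtain n where n: "\<And>g. g \<in> level n \<Longrightarrow> \<exists>U\<in>\<U>. basic g \<subseteq> U"
    using open_cover_level[OF \<U>] by (metis order_refl)
  have "open_cover SP (basic ` level n)"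
    using openin_basic points_eq_Union_level[of n] by (auto simp: open_cover_def level_iff)
  with n finite_level tree_overlap_graph_level[OF assms]
  show "\<exists>\<V>. finite \<V> \<and> open_cover SP \<V> \<and> (\<forall>V\<in>\<V>. \<exists>U\<in>\<U>. V \<subseteq> U) \<and> tree (overlap_graph \<V>)"
    by (intro exI[of _ "basic ` level n"]) simp
qed

section \<open>Monotone sequences and local connectedness\<close>

text \<open>Monotonicity is applied to a single vertex: its preimage at level \<open>m\<close>,
  which consists of the vertices below \<open>p\<close>, is connected.\<close>

lemma monotone_below_split:
  assumes mono: "seq_has monotone_rel G R" and p: "p \<in> P" "fst p < m"
    and AB: "A \<union> B = {g \<in> level m. g \<preceq> p}" "A \<inter> B = {}" "A \<noteq> {}" "B \<noteq> {}"
  obtains a b where "a \<in> A" "b \<in> B" "nbr a b"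
proof -
  obtain n x where [simp]: "p = (n, x)" by (metis surj_pair)
  have "monotone_rel (G m) (G n) (R n m)"
    using mono p(2) by (simp add: seq_has_def)
  moreover have "gconnected (G n) {x}"
    using p(1) unfolding gconnected_def induced_carrier_def by (auto simp: Un_singleton_iff)
  ultimately have "gconnected (G m) (R n m `` {x})" by (simp add: monotone_rel_def)
  moreover have "{g \<in> level m. g \<preceq> p} = Pair m ` (R n m `` {x})"
    using p(2) leD(1)[of _ p] by (force simp: level_def le_iff induced_carrier_def)
  ultimately show thesis
    using gconnected_level_split AB that by metis
qed

text \<open>Normality enlarges a separation of the closure to disjoint open \<open>U\<close> and
  \<open>V\<close>. At a deep level each vertex below \<open>p\<close> has its basic set inside one
  of them, and both cases occur; an edge between the two kinds then gives a point in
  \<open>U\<close> and \<open>V\<close>.\<close>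

lemma connectedin_closure_basic:
  assumes EF: "edge_faithful G R" and H: "Hausdorff_space SP"
    and mono: "seq_has monotone_rel G R" and p: "p \<in> P"
  shows "connectedin SP (SP closure_of basic p)"
  unfolding connectedin_closedin
proof (intro conjI notI closure_of_subset_topspace, elim exE conjE)
  let ?K = "SP closure_of basic p"
  fix E1 E2
  assume E: "closedin SP E1" "closedin SP E2" "?K \<subseteq> E1 \<union> E2" "E1 \<inter> E2 \<inter> ?K = {}"
    "E1 \<inter> ?K \<noteq> {}" "E2 \<inter> ?K \<noteq> {}"
  have "normal_space SP"
    using compact_SP H by (simp add: compact_Hausdorff_or_regular_imp_normal_space)
  moreover have "closedin SP (E1 \<inter> ?K)" "closedin SP (E2 \<inter> ?K)" "disjnt (E1 \<inter> ?K) (E2 \<inter> ?K)"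
    using E by (auto simp: disjnt_def)
  ultimately obtain U V where UV: "openin SP U" "openin SP V" "E1 \<inter> ?K \<subseteq> U" "E2 \<inter> ?K \<subseteq> V"
    "disjnt U V" unfolding normal_space_def by metis
  have pK: "basic p \<subseteq> ?K"
    by (rule closure_of_subset) (auto simp: basic_def)
  \<comment> \<open>The complement of the closure completes \<open>U\<close> and \<open>V\<close> to
    a cover of the whole spectrum, as \<open>open_cover_level\<close> requires.\<close>
  have "openin SP (points - ?K)" by (metis closedin_closure_of openin_diff openin_topspace topspace_SP)
  with UV(1,2) have op: "openin SP W" if "W \<in> {U, V, points - ?K}" for W using that by auto
  have "x \<in> U \<union> V" if x: "x \<in> ?K" for x
  proof -
    from x E(3) have "x \<in> E1 \<or> x \<in> E2" by (meson UnE subsetD)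
    with x have "x \<in> E1 \<inter> ?K \<or> x \<in> E2 \<inter> ?K" by simp
    with UV(3,4) show ?thesis by (meson UnI1 UnI2 subsetD)
  qed
  then have "points \<subseteq> \<Union>{U, V, points - ?K}" by auto
  with op obtain n where n: "\<forall>m\<ge>n. \<forall>g\<in>level m. \<exists>W\<in>{U, V, points - ?K}. basic g \<subseteq> W"
    using open_cover_level[of "{U, V, points - ?K}"] by metis
  \<comment> \<open>The successor is taken because \<open>seq_has\<close> speaks of strictly
    increasing indices only.\<close>
  define m where "m = max n (Suc (fst p))"
  have m: "m \<ge> n" "fst p < m" by (simp_all add: m_def)
  define A where "A = {g \<in> level m. g \<preceq> p \<and> basic g \<subseteq> U}"
  define B where "B = {g \<in> level m. g \<preceq> p \<and> basic g \<subseteq> V}"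
  have cover: "basic g \<subseteq> U \<or> basic g \<subseteq> V" if g: "g \<in> level m" "g \<preceq> p" for g
  proof -
    have "g \<in> P" using g(1) by (simp add: level_iff)
    then have "basic g \<noteq> {}" by (rule basic_nonempty)
    moreover have "basic g \<subseteq> ?K" using basic_mono[OF g(2)] pK by simp
    ultimately have "\<not> basic g \<subseteq> points - ?K" by blast
    moreover have "\<exists>W\<in>{U, V, points - ?K}. basic g \<subseteq> W" using n m(1) g(1) by blast
    ultimately show ?thesis by auto
  qed
  \<comment> \<open>An open set that meets the closure meets \<open>basic p\<close> itself. This
    will show that neither \<open>A\<close> nor \<open>B\<close> is empty.\<close>
  have not_sub: "\<not> basic p \<subseteq> W"
    if W: "openin SP W'" "W \<inter> W' = {}" "W' \<inter> ?K \<noteq> {}" for W W'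
    using openin_Int_closure_of_eq_empty[OF W(1), of "basic p"] W(2,3) by blast
  have ex_g: "\<exists>g\<in>level m. g \<preceq> p \<and> S \<in> basic g" if "S \<in> basic p" for S
  proof -
    have "S \<in> points" "p \<in> S" using that by (simp_all add: basic_def)
    then obtain g where "g \<in> S" "g \<in> level m" "g \<preceq> p"
      using point_below_at_level m(2) by (metis less_imp_le)
    with \<open>S \<in> points\<close> show ?thesis by (auto simp: basic_def)
  qed
  have "A \<union> B = {g \<in> level m. g \<preceq> p}" using cover by (auto simp: A_def B_def)
  moreover have "A \<inter> B = {}"
  proof (rule equals0I)
    fix g assume "g \<in> A \<inter> B"
    then have "basic g \<subseteq> U \<inter> V" "g \<in> P" by (auto simp: A_def B_def level_iff)
    with basic_nonempty[of g] UV(5) show False by (simp add: disjnt_def)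
  qed
  moreover have "A \<noteq> {}"
  proof
    assume "A = {}"
    then have sub: "basic g \<subseteq> V" if "g \<in> level m" "g \<preceq> p" for g
      using cover[OF that] that unfolding A_def by blast
    have "basic p \<subseteq> V"
    proof
      fix S assume "S \<in> basic p"
      from ex_g[OF this] obtain g where "g \<in> level m" "g \<preceq> p" "S \<in> basic g" by metis
      with sub show "S \<in> V" by (metis subsetD)
    qed
    moreover have "V \<inter> U = {}" using UV(5) by (simp add: disjnt_def Int_commute)
    moreover have "U \<inter> ?K \<noteq> {}" using UV(3) E(5) by blast
    ultimately show False using not_sub[OF UV(1)] by metis
  qed
  moreover have "B \<noteq> {}"
  proof
    assume "B = {}"
    then have sub: "basic g \<subseteq> U" if "g \<in> level m" "g \<preceq> p" for g
      using cover[OF that] that unfolding B_def by blast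
    have "basic p \<subseteq> U"
    proof
      fix S assume "S \<in> basic p"
      from ex_g[OF this] obtain g where "g \<in> level m" "g \<preceq> p" "S \<in> basic g" by metis
      with sub show "S \<in> U" by (metis subsetD)
    qed
    moreover have "U \<inter> V = {}" using UV(5) by (simp add: disjnt_def)
    moreover have "V \<inter> ?K \<noteq> {}" using UV(4) E(6) by blast
    ultimately show False using not_sub[OF UV(2)] by metis
  qed
  ultimately obtain a b where ab: "a \<in> A" "b \<in> B" "nbr a b"
    using monotone_below_split[OF mono p m(2)] by metis
  obtain S where "S \<in> basic a" "S \<in> basic b" using nbr_imp_ex_point[OF EF ab(3)] .
  with ab UV(5) show False by (auto simp: A_def B_def disjnt_def)
qed

text \<open>By regularity, some \<open>basic p\<close> around the point has its closure inside the
  given open set. That closure is a connected neighbourhood but possibly not open, hence the detour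
  through weak local connectedness.\<close>

lemma locally_connected_SP:
  assumes EF: "edge_faithful G R" and H: "Hausdorff_space SP"
    and mono: "seq_has monotone_rel G R"
  shows "locally_connected_space SP"
  unfolding locally_connected_space_iff_weak weakly_locally_connected_at_def neighbourhood_base_at_def
proof (intro ballI allI impI, elim conjE)
  fix S W assume W: "openin SP W" "S \<in> W"
  have "regular_space SP" using compact_Hausdorff_imp_regular_space compact_SP H by blast
  then obtain U C where U: "openin SP U" "closedin SP C" "S \<in> U" "U \<subseteq> C" "C \<subseteq> W"
    using W unfolding neighbourhood_base_of_closedin[symmetric] neighbourhood_base_of by metis
  obtain p where p: "p \<in> S" "basic p \<subseteq> U" using U(1,3) unfolding openin_SP_iff by metis
  have S: "S \<in> points" using U(1,3) openin_subset by force
  then have "p \<in> P" using p(1) point_subset by blast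
  have "basic p \<subseteq> C" using p(2) U(4) by simp
  then have "SP closure_of basic p \<subseteq> W"
    using closure_of_minimal[OF _ U(2)] U(5) by (metis subset_trans)
  moreover have "basic p \<subseteq> SP closure_of basic p"
    by (rule closure_of_subset) (auto simp: basic_def)
  moreover have "S \<in> basic p" using S p(1) by (simp add: basic_def)
  ultimately show "\<exists>U V. openin SP U \<and> connectedin SP V \<and> S \<in> U \<and> U \<subseteq> V \<and> V \<subseteq> W"
    using openin_basic[OF \<open>p \<in> P\<close>] connectedin_closure_basic[OF EF H mono \<open>p \<in> P\<close>] by metis
qed

lemma continuum_SP: "connected_space SP \<Longrightarrow> Hausdorff_space SP \<Longrightarrow> continuum SP"
  using points_nonempty compact_SP second_countable_SP
  by (simp add: continuum_def compact_Hausdorff_second_countable_imp_metrizable_space)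

end

theorem corollary4p27:
  fixes G :: "nat \<Rightarrow> 'a rgraph"
    and R :: "nat \<Rightarrow> nat \<Rightarrow> ('a \<times> 'a) set"
  assumes "B_sequence G R"
    and "\<And>n. tree (G n)"
  defines "SP \<equiv> spectrum (induced_carrier G) (induced_order G R)"
  shows "(connected_space SP \<and> Hausdorff_space SP \<longleftrightarrow>
            has_subseq_with edge_witnessing G R \<and> has_subseq_with star_refining G R) \<and>
         (connected_space SP \<and> Hausdorff_space SP \<longrightarrow>
            edge_faithful G R \<and> continuum SP \<and> tree_like SP) \<and>
         (connected_space SP \<and> Hausdorff_space SP \<and> seq_has monotone_rel G R \<longrightarrow> dendrite SP)"
proof -
  interpret tree_seq G R
    using assms(1,2) by unfold_locales
  show ?thesis
    unfolding SP_def dendrite_def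
    using edge_witnessing_imp_edge_faithful edge_faithful_imp_connected star_refining_imp_Hausdorff
      connected_imp_edge_faithful edge_faithful_imp_edge_witnessing Hausdorff_imp_star_refining
      continuum_SP tree_like_SP locally_connected_SP
    by blast
qed

end
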